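(* Let $\wp$ be the asymptotic limit functor, which assigns a group to every inverse system of groups indexed by the non-negative integers. Then: (1) $\wp$ is exact: if $\Phi=\{\phi_n\}\colon\underline A\to\underline B$ and $\Psi=\{\psi_n\}\colon\underline B\to\underline C$ are morphisms of inverse systems of groups such that $1\to A_n\xrightarrow{\phi_n}B_n\xrightarrow{\psi_n}C_n\to1$ is exact for every $n\ge0$, then $1\to\wp(\underline A)\xrightarrow{\wp(\Phi)}\wp(\underline B)\xrightarrow{\wp(\Psi)}\wp(\underline C)\to1$ is exact. (2) For an inverse system of groups $\underline G$, the group $\wp(\underline G)$ is trivial if and only if $\underline G$ is pro-isomorphic to the inverse system of trivial groups; otherwise, $\wp(\underline G)$ is uncountable. (3) If $\underline G$ is an inverse system of abelian groups, there is an exact sequence $$0\longrightarrow\varprojlim\underline G\longrightarrow\wp(\underline G)\xrightarrow{\ \Phi^\infty\ }\wp(\underline G)\longrightarrow\varprojlim{}^{1}\,\underline G\longrightarrow0,$$ where $\Phi^\infty$ is the induced shift operator.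
   Context: Inverse systems. An inverse system of groups is $\underline G=\{G_n,p^m_n\}_{m\ge n\ge0}$ with groups $G_n$ and homomorphisms $p^m_n\colon G_m\to G_n$ such that $p^n_n=\mathrm{id}$ and $p^m_n\circ p^k_m=p^k_n$ for $k\ge m\ge n$. A morphism $\{G_n,p^m_n\}\to\{H_n,q^m_n\}$ is a sequence of homomorphisms $\phi_n\colon G_n\to H_n$ with $q^m_n\circ\phi_m=\phi_n\circ p^m_n$ for all $m\ge n$. Asymptotic limit. Let $\mathscr S_{\underline G}$ be the set of sequences $\{g_{k(n)}\}_{n\ge0}$ with $g_{k(n)}\in G_{k(n)}$, where $k(n)$ are non-negative integers with $k(n)\to\infty$. Put $\{g_{k(n)}\}\sim\{g'_{l(n)}\}$ if there are integers $m(n)\ge 0$ with $m(n)\to\infty$, $m(n)\le\min\{k(n),l(n)\}$, and $p^{k(n)}_{m(n)}(g_{k(n)})=p^{l(n)}_{m(n)}(g'_{l(n)})$ for all sufficiently large $n$. Then $\wp(\underline G)=\mathscr S_{\underline G}/{\sim}$, a group under $[\{g_{k(n)}\}]\cdot[\{h_{l(n)}\}]=[\{p^{k(n)}_{m(n)}(g_{k(n)})\,p^{l(n)}_{m(n)}(h_{l(n)})\}]$ with $m(n)=\min\{k(n),l(n)\}$. For a morphism, $\wp(\Phi)([\{g_{k(n)}\}])=[\{\phi_{k(n)}(g_{k(n)})\}]$. Pro-isomorphism. $\underline G=\{G_n,p^m_n\}$ and $\underline H=\{H_n,q^m_n\}$ are pro-isomorphic if there are strictly increasing index sequences $i_0<i_1<\cdots$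 and $j_0<j_1<\cdots$ and homomorphisms $\lambda_n\colon G_{i_{n+1}}\to H_{j_n}$, $\mu_n\colon H_{j_n}\to G_{i_n}$ with $\mu_n\circ\lambda_n=p^{i_{n+1}}_{i_n}$ and $\lambda_n\circ\mu_{n+1}=q^{j_{n+1}}_{j_n}$ for all $n\ge0$. Limits. For abelian $G_n$, $\varprojlim\underline G$ and $\varprojlim^1\underline G$ are the kernel and cokernel of $\Delta\colon\prod_nG_n\to\prod_nG_n$, $(\Delta(x))_n=x_n-p^{n+1}_n(x_{n+1})$. Induced shift operator (abelian case). Every element of $\wp(\underline G)$ has a representative $\{x_{k(n)}\}$ whose index sequence $k(n)$ is non-decreasing, and $\Phi^\infty\colon\wp(\underline G)\to\wp(\underline G)$ is the well-defined homomorphism given on such representatives by $\Phi^\infty([\{x_{k(n)}\}])=[\{x_{k(n)}-p^{k(n+1)}_{k(n)}(x_{k(n+1)})\}]$. (Equivalently, it is the direct limit, over non-decreasing divergent index sequences $\bm k$, of the operators induced by this formula on $\prod_nG_{k(n)}/\bigoplus_nG_{k(n)}$.) *)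

theory Defs
  imports "HOL-Algebra.Product_Groups" "HOL-Library.Countable_Set"
begin

text \<open>
  All groups of one inverse system live in a common type; this is no restriction, since any
  sequence of groups can be transported into one type. Different systems may use different types.
  The bonding map from \<open>G m\<close> to \<open>G n\<close> is \<open>p m n\<close>; its value is only meaningful for \<open>n \<le> m\<close> and on
  \<open>carrier (G m)\<close>.
\<close>

locale inverse_system =
  fixes G :: "nat \<Rightarrow> 'a monoid" and p :: "nat \<Rightarrow> nat \<Rightarrow> 'a \<Rightarrow> 'a"
  assumes group_obj: "group (G n)"
    and hom_bond: "n \<le> m \<Longrightarrow> p m n \<in> hom (G m) (G n)"
    and bond_id: "x \<in> carrier (G n) \<Longrightarrow> p n n x = x"
    and bond_comp: "\<lbrakk>n \<le> m; m \<le> k; x \<in> carrier (G k)\<rbrakk> \<Longrightarrow> p m n (p k m x) = p k n x"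

locale inverse_system_morphism =
  source: inverse_system G p + target: inverse_system H q
  for G :: "nat \<Rightarrow> 'a monoid" and p and H :: "nat \<Rightarrow> 'b monoid" and q +
  fixes \<phi> :: "nat \<Rightarrow> 'a \<Rightarrow> 'b"
  assumes hom_component: "\<phi> n \<in> hom (G n) (H n)"
    and commutes: "\<lbrakk>n \<le> m; x \<in> carrier (G m)\<rbrakk> \<Longrightarrow> q m n (\<phi> m x) = \<phi> n (p m n x)"

definition trivial_system :: "nat \<Rightarrow> unit monoid" where
  "trivial_system = (\<lambda>n. singleton_group ())"

definition trivial_bond :: "nat \<Rightarrow> nat \<Rightarrow> unit \<Rightarrow> unit" where
  "trivial_bond = (\<lambda>m n x. x)"

definition pro_isomorphic ::
  "(nat \<Rightarrow> 'a monoid) \<Rightarrow> (nat \<Rightarrow> nat \<Rightarrow> 'a \<Rightarrow> 'a) \<Rightarrow>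
   (nat \<Rightarrow> 'b monoid) \<Rightarrow> (nat \<Rightarrow> nat \<Rightarrow> 'b \<Rightarrow> 'b) \<Rightarrow> bool"
where
  "pro_isomorphic G p H q \<longleftrightarrow>
    (\<exists>(i :: nat \<Rightarrow> nat) (j :: nat \<Rightarrow> nat) (\<alpha> :: nat \<Rightarrow> 'a \<Rightarrow> 'b) (\<beta> :: nat \<Rightarrow> 'b \<Rightarrow> 'a).
       strict_mono i \<and> strict_mono j \<and>
       (\<forall>n. \<alpha> n \<in> hom (G (i (Suc n))) (H (j n))) \<and>
       (\<forall>n. \<beta> n \<in> hom (H (j n)) (G (i n))) \<and>
       (\<forall>n. \<forall>x \<in> carrier (G (i (Suc n))). \<beta> n (\<alpha> n x) = p (i (Suc n)) (i n) x) \<and>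
       (\<forall>n. \<forall>y \<in> carrier (H (j (Suc n))). \<alpha> n (\<beta> (Suc n) y) = q (j (Suc n)) (j n) y))"


section \<open>The asymptotic limit\<close>

text \<open>A sequence of elements \<open>g n \<in> G (k n)\<close> is the pair \<open>(k, g)\<close>.\<close>

type_synonym 'a asym_seq = "(nat \<Rightarrow> nat) \<times> (nat \<Rightarrow> 'a)"

definition asym_seqs :: "(nat \<Rightarrow> 'a monoid) \<Rightarrow> 'a asym_seq set" where
  "asym_seqs G = {(k, g). filterlim k at_top sequentially \<and> (\<forall>n. g n \<in> carrier (G (k n)))}"

definition asym_rel ::
  "(nat \<Rightarrow> 'a monoid) \<Rightarrow> (nat \<Rightarrow> nat \<Rightarrow> 'a \<Rightarrow> 'a) \<Rightarrow> ('a asym_seq \<times> 'a asym_seq) set"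
where
  "asym_rel G p =
    {((k, g), (l, h)). (k, g) \<in> asym_seqs G \<and> (l, h) \<in> asym_seqs G \<and>
       (\<exists>m :: nat \<Rightarrow> nat. filterlim m at_top sequentially \<and> (\<forall>n. m n \<le> min (k n) (l n)) \<and>
          (\<forall>\<^sub>F n in sequentially. p (k n) (m n) (g n) = p (l n) (m n) (h n)))}"

definition asym_class ::
  "(nat \<Rightarrow> 'a monoid) \<Rightarrow> (nat \<Rightarrow> nat \<Rightarrow> 'a \<Rightarrow> 'a) \<Rightarrow> 'a asym_seq \<Rightarrow> 'a asym_seq set"
where
  "asym_class G p s = asym_rel G p `` {s}"

definition seq_mult ::
  "(nat \<Rightarrow> 'a monoid) \<Rightarrow> (nat \<Rightarrow> nat \<Rightarrow> 'a \<Rightarrow> 'a) \<Rightarrow> 'a asym_seq \<Rightarrow> 'a asym_seq \<Rightarrow> 'a asym_seq"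
where
  "seq_mult G p = (\<lambda>(k, g) (l, h).
     (\<lambda>n. min (k n) (l n),
      \<lambda>n. p (k n) (min (k n) (l n)) (g n)
            \<otimes>\<^bsub>G (min (k n) (l n))\<^esub> p (l n) (min (k n) (l n)) (h n)))"

text \<open>
  Operations on classes are unions over representatives, as usual for quotients; independence of
  the representative is proved in \<open>mult_asym_class\<close>, \<open>asym_map_class\<close> and \<open>asym_shift_class\<close> below.
\<close>

definition asym_limit ::
  "(nat \<Rightarrow> 'a monoid) \<Rightarrow> (nat \<Rightarrow> nat \<Rightarrow> 'a \<Rightarrow> 'a) \<Rightarrow> 'a asym_seq set monoid"
where
  "asym_limit G p =
    \<lparr>carrier = asym_seqs G // asym_rel G p,
     monoid.mult = (\<lambda>X Y. \<Union>s\<in>X. \<Union>t\<in>Y. asym_class G p (seq_mult G p s t)),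
     one = asym_class G p (\<lambda>n. n, \<lambda>n. \<one>\<^bsub>G n\<^esub>)\<rparr>"

definition asym_map ::
  "(nat \<Rightarrow> 'b monoid) \<Rightarrow> (nat \<Rightarrow> nat \<Rightarrow> 'b \<Rightarrow> 'b) \<Rightarrow> (nat \<Rightarrow> 'a \<Rightarrow> 'b) \<Rightarrow>
   'a asym_seq set \<Rightarrow> 'b asym_seq set"
where
  "asym_map H q \<phi> X = (\<Union>(k, g)\<in>X. asym_class H q (k, \<lambda>n. \<phi> (k n) (g n)))"


section \<open>Limits and the shift operator for systems of abelian groups\<close>

text \<open>The abelian groups are written multiplicatively, as in HOL-Algebra.\<close>

definition lim_diff ::
  "(nat \<Rightarrow> 'a monoid) \<Rightarrow> (nat \<Rightarrow> nat \<Rightarrow> 'a \<Rightarrow> 'a) \<Rightarrow> (nat \<Rightarrow> 'a) \<Rightarrow> (nat \<Rightarrow> 'a)"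
where
  "lim_diff G p x = (\<lambda>n. x n \<otimes>\<^bsub>G n\<^esub> inv\<^bsub>G n\<^esub> p (Suc n) n (x (Suc n)))"

definition inv_limit :: "(nat \<Rightarrow> 'a monoid) \<Rightarrow> (nat \<Rightarrow> nat \<Rightarrow> 'a \<Rightarrow> 'a) \<Rightarrow> (nat \<Rightarrow> 'a) monoid" where
  "inv_limit G p =
    (product_group UNIV G)
      \<lparr>carrier := kernel (product_group UNIV G) (product_group UNIV G) (lim_diff G p)\<rparr>"

definition inv_limit1 ::
  "(nat \<Rightarrow> 'a monoid) \<Rightarrow> (nat \<Rightarrow> nat \<Rightarrow> 'a \<Rightarrow> 'a) \<Rightarrow> (nat \<Rightarrow> 'a) set monoid"
where
  "inv_limit1 G p = product_group UNIV G Mod (lim_diff G p ` carrier (product_group UNIV G))"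

definition asym_shift ::
  "(nat \<Rightarrow> 'a monoid) \<Rightarrow> (nat \<Rightarrow> nat \<Rightarrow> 'a \<Rightarrow> 'a) \<Rightarrow> 'a asym_seq set \<Rightarrow> 'a asym_seq set"
where
  "asym_shift G p X =
    (\<Union>(k, x)\<in>{(k, x) \<in> X. mono k}.
       asym_class G p
         (k, \<lambda>n. x n \<otimes>\<^bsub>G (k n)\<^esub> inv\<^bsub>G (k n)\<^esub> p (k (Suc n)) (k n) (x (Suc n))))"


section \<open>Exactness\<close>

text \<open>
  The library's \<open>exact_seq\<close> requires all groups of a sequence to live in one type, hence this
  heterogeneous version: exactness of \<open>G \<rightarrow> H \<rightarrow> K\<close> at \<open>H\<close>.
\<close>

definition exact_at ::
  "'a monoid \<Rightarrow> ('a \<Rightarrow> 'b) \<Rightarrow> 'b monoid \<Rightarrow> ('b \<Rightarrow> 'c) \<Rightarrow> 'c monoid \<Rightarrow> bool"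
where
  "exact_at G f H g K \<longleftrightarrow>
     group_hom G H f \<and> group_hom H K g \<and> f ` carrier G = kernel H K g"

definition short_exact ::
  "'a monoid \<Rightarrow> ('a \<Rightarrow> 'b) \<Rightarrow> 'b monoid \<Rightarrow> ('b \<Rightarrow> 'c) \<Rightarrow> 'c monoid \<Rightarrow> bool"
where
  "short_exact A f B g C \<longleftrightarrow>
     exact_at (singleton_group ()) (\<lambda>_. \<one>\<^bsub>A\<^esub>) A f B \<and>
     exact_at A f B g C \<and>
     exact_at B g C (\<lambda>_. ()) (singleton_group ())"


section \<open>Well-definedness\<close>

lemma filterlim_min_at_top_nat:
  fixes k l :: "nat \<Rightarrow> nat"
  assumes "filterlim k at_top sequentially" "filterlim l at_top sequentially"
  shows "filterlim (\<lambda>n. min (k n) (l n)) at_top sequentially"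
  unfolding filterlim_at_top
proof
  fix Z
  show "\<forall>\<^sub>F n in sequentially. Z \<le> min (k n) (l n)"
    using assms[unfolded filterlim_at_top, rule_format, of Z]
    by eventually_elim simp
qed

lemma mono_minorant:
  fixes k :: "nat \<Rightarrow> nat"
  assumes "filterlim k at_top sequentially"
  obtains m where "mono m" "\<And>n. m n \<le> k n" "filterlim m at_top sequentially"
proof
  define m where "m n = (LEAST v. v \<in> k ` {n..})" for n
  have mem: "m n \<in> k ` {n..}" for n
    unfolding m_def by (rule LeastI[of _ "k n"]) auto
  have le: "m n \<le> k j" if "n \<le> j" for n j
    unfolding m_def by (rule Least_le) (use that in auto)
  show "m n \<le> k n" for n by (rule le) simp
  show "mono m"
  proof (rule monoI)
    fix a b :: nat assume "a \<le> b"
    from mem[of b] obtain j where "j \<ge> b" "m b = k j" by auto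
    with le[of a j] \<open>a \<le> b\<close> show "m a \<le> m b" by simp
  qed
  show "filterlim m at_top sequentially"
    unfolding filterlim_at_top
  proof
    fix Z
    from assms[unfolded filterlim_at_top, rule_format, of Z]
    obtain N where N: "\<And>n. n \<ge> N \<Longrightarrow> Z \<le> k n" unfolding eventually_sequentially by auto
    have "Z \<le> m n" if "n \<ge> N" for n
    proof -
      from mem[of n] obtain j where "j \<ge> n" "m n = k j" by auto
      with N that show ?thesis by simp
    qed
    then show "\<forall>\<^sub>F n in sequentially. Z \<le> m n" unfolding eventually_sequentially by auto
  qed
qed

lemma asym_seqs_iff:
  "(k, g) \<in> asym_seqs G \<longleftrightarrow> filterlim k at_top sequentially \<and> (\<forall>n. g n \<in> carrier (G (k n)))"
  by (simp add: asym_seqs_def)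

context inverse_system
begin

lemma bond_closed: "\<lbrakk>n \<le> m; x \<in> carrier (G m)\<rbrakk> \<Longrightarrow> p m n x \<in> carrier (G n)"
  using hom_bond unfolding hom_def by blast

lemma bond_mult:
  "\<lbrakk>n \<le> m; x \<in> carrier (G m); y \<in> carrier (G m)\<rbrakk>
    \<Longrightarrow> p m n (x \<otimes>\<^bsub>G m\<^esub> y) = p m n x \<otimes>\<^bsub>G n\<^esub> p m n y"
  using hom_bond unfolding hom_def by blast

lemma group_hom_bond: "n \<le> m \<Longrightarrow> group_hom (G m) (G n) (p m n)"
  by (intro group_hom.intro group_obj group_hom_axioms.intro hom_bond)

lemma bond_one: "n \<le> m \<Longrightarrow> p m n \<one>\<^bsub>G m\<^esub> = \<one>\<^bsub>G n\<^esub>"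
  by (rule group_hom.hom_one[OF group_hom_bond])

lemma bond_inv:
  "\<lbrakk>n \<le> m; x \<in> carrier (G m)\<rbrakk> \<Longrightarrow> p m n (inv\<^bsub>G m\<^esub> x) = inv\<^bsub>G n\<^esub> p m n x"
  by (rule group_hom.hom_inv[OF group_hom_bond])

lemmas obj_simps = group.is_monoid[OF group_obj] monoid.m_closed[OF group.is_monoid[OF group_obj]]
  monoid.one_closed[OF group.is_monoid[OF group_obj]] group.inv_closed[OF group_obj]
  bond_closed bond_mult bond_one bond_inv bond_comp bond_id

lemma asym_relI:
  assumes "(k, g) \<in> asym_seqs G" "(l, h) \<in> asym_seqs G" "filterlim m at_top sequentially"
    and "\<And>n. m n \<le> k n" "\<And>n. m n \<le> l n"
    and "\<forall>\<^sub>F n in sequentially. p (k n) (m n) (g n) = p (l n) (m n) (h n)"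
  shows "((k, g), (l, h)) \<in> asym_rel G p"
  using assms unfolding asym_rel_def by auto

lemma asym_relE:
  assumes "((k, g), (l, h)) \<in> asym_rel G p"
  obtains m where "(k, g) \<in> asym_seqs G" "(l, h) \<in> asym_seqs G" "mono m"
    "filterlim m at_top sequentially" "\<And>n. m n \<le> k n" "\<And>n. m n \<le> l n"
    "\<forall>\<^sub>F n in sequentially. p (k n) (m n) (g n) = p (l n) (m n) (h n)"
proof -
  from assms obtain m where m: "filterlim m at_top sequentially" "\<And>n. m n \<le> min (k n) (l n)"
    "\<forall>\<^sub>F n in sequentially. p (k n) (m n) (g n) = p (l n) (m n) (h n)"
    and s: "(k, g) \<in> asym_seqs G" "(l, h) \<in> asym_seqs G"
    unfolding asym_rel_def by auto
  obtain m' where m': "mono m'" "\<And>n. m' n \<le> m n" "filterlim m' at_top sequentially"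
    using mono_minorant[OF m(1)] by blast
  have le: "m n \<le> k n" "m n \<le> l n" for n using m(2)[of n] by auto
  have "\<forall>\<^sub>F n in sequentially. p (k n) (m' n) (g n) = p (l n) (m' n) (h n)"
    using m(3)
  proof eventually_elim
    case (elim n)
    have "p (k n) (m' n) (g n) = p (m n) (m' n) (p (k n) (m n) (g n))"
      using s le m'(2) by (simp add: bond_comp asym_seqs_iff)
    also have "\<dots> = p (l n) (m' n) (h n)"
      using s le m'(2) elim by (simp add: bond_comp asym_seqs_iff)
    finally show ?case .
  qed
  with s m' le show ?thesis by (intro that[of m']) (auto intro: order_trans)
qed

lemma equiv_asym_rel: "equiv (asym_seqs G) (asym_rel G p)"
proof (rule equivI)
  show "asym_rel G p \<subseteq> asym_seqs G \<times> asym_seqs G"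
    unfolding asym_rel_def by auto
  show "refl_on (asym_seqs G) (asym_rel G p)"
  proof (rule refl_onI)
    fix s assume "s \<in> asym_seqs G"
    then show "(s, s) \<in> asym_rel G p"
      by (cases s) (auto intro!: asym_relI[where m = "fst s"] simp: asym_seqs_iff)
  qed
  show "sym (asym_rel G p)"
    unfolding sym_def asym_rel_def by (auto simp: min.commute eq_commute)
  show "trans (asym_rel G p)"
  proof (rule transI, clarify)
    fix k g l h j f
    assume "((k, g), (l, h)) \<in> asym_rel G p" "((l, h), (j, f)) \<in> asym_rel G p"
    then obtain m m' where s: "(k, g) \<in> asym_seqs G" "(l, h) \<in> asym_seqs G" "(j, f) \<in> asym_seqs G"
      and m: "filterlim m at_top sequentially" "\<And>n. m n \<le> k n" "\<And>n. m n \<le> l n"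
        "\<forall>\<^sub>F n in sequentially. p (k n) (m n) (g n) = p (l n) (m n) (h n)"
      and m': "filterlim m' at_top sequentially" "\<And>n. m' n \<le> l n" "\<And>n. m' n \<le> j n"
        "\<forall>\<^sub>F n in sequentially. p (l n) (m' n) (h n) = p (j n) (m' n) (f n)"
      by (elim asym_relE) blast
    let ?M = "\<lambda>n. min (m n) (m' n)"
    show "((k, g), (j, f)) \<in> asym_rel G p"
    proof (rule asym_relI[where m = ?M])
      show "\<forall>\<^sub>F n in sequentially. p (k n) (?M n) (g n) = p (j n) (?M n) (f n)"
        using m(4) m'(4)
      proof eventually_elim
        case (elim n)
        have "p (k n) (?M n) (g n) = p (m n) (?M n) (p (k n) (m n) (g n))"
          using s m(2)[of n] by (simp add: bond_comp asym_seqs_iff)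
        also have "\<dots> = p (l n) (?M n) (h n)"
          using s m(3)[of n] by (simp add: bond_comp asym_seqs_iff elim)
        also have "\<dots> = p (m' n) (?M n) (p (l n) (m' n) (h n))"
          using s m'(2)[of n] by (simp add: bond_comp asym_seqs_iff)
        also have "\<dots> = p (j n) (?M n) (f n)"
          using s m'(3)[of n] by (simp add: bond_comp asym_seqs_iff elim)
        finally show ?case .
      qed
    qed (use s m m' in \<open>auto intro: filterlim_min_at_top_nat min.coboundedI1 min.coboundedI2\<close>)
  qed
qed

lemma asym_class_eqI: "(s, t) \<in> asym_rel G p \<Longrightarrow> asym_class G p s = asym_class G p t"
  unfolding asym_class_def by (rule equiv_class_eq[OF equiv_asym_rel])

lemma asym_class_self: "s \<in> asym_seqs G \<Longrightarrow> s \<in> asym_class G p s"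
  unfolding asym_class_def by (rule equiv_class_self[OF equiv_asym_rel])

lemma carrier_asym_limit: "carrier (asym_limit G p) = asym_class G p ` asym_seqs G"
  by (auto simp: asym_limit_def asym_class_def quotient_def)

lemma seq_mult_closed:
  "\<lbrakk>s \<in> asym_seqs G; t \<in> asym_seqs G\<rbrakk> \<Longrightarrow> seq_mult G p s t \<in> asym_seqs G"
  by (cases s; cases t)
    (simp add: seq_mult_def asym_seqs_iff filterlim_min_at_top_nat obj_simps)

lemma mult_asym_class:
  assumes "s \<in> asym_seqs G" "t \<in> asym_seqs G"
  shows "asym_class G p s \<otimes>\<^bsub>asym_limit G p\<^esub> asym_class G p t = asym_class G p (seq_mult G p s t)"
proof -
  have "(\<lambda>s t. asym_rel G p `` {seq_mult G p s t}) respects2 asym_rel G p"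
  proof (rule congruent2I')
    fix s s' t t' assume 0: "(s, s') \<in> asym_rel G p" "(t, t') \<in> asym_rel G p"
    obtain k g k' g' l h l' h' where
      e: "s = (k, g)" "s' = (k', g')" "t = (l, h)" "t' = (l', h')"
      by (metis surj_pair)
    from 0[unfolded e] obtain m m' where
      s: "(k, g) \<in> asym_seqs G" "(k', g') \<in> asym_seqs G" "(l, h) \<in> asym_seqs G" "(l', h') \<in> asym_seqs G"
      and m: "filterlim m at_top sequentially" "\<And>n. m n \<le> k n" "\<And>n. m n \<le> k' n"
        "\<forall>\<^sub>F n in sequentially. p (k n) (m n) (g n) = p (k' n) (m n) (g' n)"
      and m': "filterlim m' at_top sequentially" "\<And>n. m' n \<le> l n" "\<And>n. m' n \<le> l' n"
        "\<forall>\<^sub>F n in sequentially. p (l n) (m' n) (h n) = p (l' n) (m' n) (h' n)"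
      by (elim asym_relE) blast
    let ?M = "\<lambda>n. min (m n) (m' n)"
    have le: "?M n \<le> min (k n) (l n)" "?M n \<le> min (k' n) (l' n)" for n
      using m(2,3)[of n] m'(2,3)[of n] by auto
    have cl: "g n \<in> carrier (G (k n))" "g' n \<in> carrier (G (k' n))"
      "h n \<in> carrier (G (l n))" "h' n \<in> carrier (G (l' n))" for n
      using s by (auto simp: asym_seqs_iff)
    have "(seq_mult G p s t, seq_mult G p s' t') \<in> asym_rel G p"
      unfolding e seq_mult_def prod.case
    proof (rule asym_relI[where m = ?M])
      show "\<forall>\<^sub>F n in sequentially.
          p (min (k n) (l n)) (?M n)
            (p (k n) (min (k n) (l n)) (g n) \<otimes>\<^bsub>G (min (k n) (l n))\<^esub> p (l n) (min (k n) (l n)) (h n)) =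
          p (min (k' n) (l' n)) (?M n)
            (p (k' n) (min (k' n) (l' n)) (g' n) \<otimes>\<^bsub>G (min (k' n) (l' n))\<^esub>
             p (l' n) (min (k' n) (l' n)) (h' n))"
        using m(4) m'(4)
      proof eventually_elim
        case (elim n)
        have "p (k n) (?M n) (g n) = p (k' n) (?M n) (g' n)"
          using bond_comp[of "?M n" "m n" "k n" "g n"] bond_comp[of "?M n" "m n" "k' n" "g' n"]
            cl m(2,3)[of n] elim by simp
        moreover have "p (l n) (?M n) (h n) = p (l' n) (?M n) (h' n)"
          using bond_comp[of "?M n" "m' n" "l n" "h n"] bond_comp[of "?M n" "m' n" "l' n" "h' n"]
            cl m'(2,3)[of n] elim by simp
        ultimately show ?case
          using le[of n] cl by (simp add: obj_simps del: min.bounded_iff)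
      qed
    next
      show "(\<lambda>n. min (k n) (l n), \<lambda>n. p (k n) (min (k n) (l n)) (g n)
          \<otimes>\<^bsub>G (min (k n) (l n))\<^esub> p (l n) (min (k n) (l n)) (h n)) \<in> asym_seqs G"
        using seq_mult_closed[OF s(1,3)] by (simp add: seq_mult_def)
      show "(\<lambda>n. min (k' n) (l' n), \<lambda>n. p (k' n) (min (k' n) (l' n)) (g' n)
          \<otimes>\<^bsub>G (min (k' n) (l' n))\<^esub> p (l' n) (min (k' n) (l' n)) (h' n)) \<in> asym_seqs G"
        using seq_mult_closed[OF s(2,4)] by (simp add: seq_mult_def)
    qed (use le m m' in \<open>auto intro: filterlim_min_at_top_nat\<close>)
    then show "asym_rel G p `` {seq_mult G p s t} = asym_rel G p `` {seq_mult G p s' t'}"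
      by (rule equiv_class_eq[OF equiv_asym_rel])
  qed
  from UN_equiv_class2[OF equiv_asym_rel equiv_asym_rel this assms]
  show ?thesis by (simp add: asym_limit_def asym_class_def)
qed

lemma one_seq: "(\<lambda>n. n, \<lambda>n. \<one>\<^bsub>G n\<^esub>) \<in> asym_seqs G"
  by (simp add: asym_seqs_iff obj_simps filterlim_ident)

lemma group_asym_limit: "group (asym_limit G p)"
proof (rule groupI)
  let ?W = "asym_limit G p"
  have one: "\<one>\<^bsub>?W\<^esub> = asym_class G p (\<lambda>n. n, \<lambda>n. \<one>\<^bsub>G n\<^esub>)"
    by (simp add: asym_limit_def)
  show "\<one>\<^bsub>?W\<^esub> \<in> carrier ?W"
    unfolding one carrier_asym_limit using one_seq by blast
  show "x \<otimes>\<^bsub>?W\<^esub> y \<in> carrier ?W" if "x \<in> carrier ?W" "y \<in> carrier ?W" for x y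
    using that unfolding carrier_asym_limit by (auto simp: mult_asym_class seq_mult_closed)
  show "x \<otimes>\<^bsub>?W\<^esub> y \<otimes>\<^bsub>?W\<^esub> z = x \<otimes>\<^bsub>?W\<^esub> (y \<otimes>\<^bsub>?W\<^esub> z)"
    if xyz: "x \<in> carrier ?W" "y \<in> carrier ?W" "z \<in> carrier ?W" for x y z
  proof -
    from xyz obtain s t u where s: "s \<in> asym_seqs G" "t \<in> asym_seqs G" "u \<in> asym_seqs G"
      "x = asym_class G p s" "y = asym_class G p t" "z = asym_class G p u"
      unfolding carrier_asym_limit by blast
    have "seq_mult G p (seq_mult G p s t) u = seq_mult G p s (seq_mult G p t u)"
    proof -
      obtain k g l h j f where e: "s = (k, g)" "t = (l, h)" "u = (j, f)"
        by (metis surj_pair)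
      have cl: "g n \<in> carrier (G (k n))" "h n \<in> carrier (G (l n))" "f n \<in> carrier (G (j n))" for n
        using s(1-3) by (auto simp: e asym_seqs_iff)
      have "p (min (k n) (l n)) M
              (p (k n) (min (k n) (l n)) (g n) \<otimes>\<^bsub>G (min (k n) (l n))\<^esub> p (l n) (min (k n) (l n)) (h n))
            \<otimes>\<^bsub>G M\<^esub> p (j n) M (f n) =
          p (k n) M (g n) \<otimes>\<^bsub>G M\<^esub>
            p (min (l n) (j n)) M
              (p (l n) (min (l n) (j n)) (h n) \<otimes>\<^bsub>G (min (l n) (j n))\<^esub> p (j n) (min (l n) (j n)) (f n))"
        if M: "M = min (k n) (min (l n) (j n))" for M n
      proof -
        have le: "M \<le> k n" "M \<le> l n" "M \<le> j n" "M \<le> min (k n) (l n)" "M \<le> min (l n) (j n)"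
          using M by auto
        have "monoid (G M)" by (rule group.is_monoid[OF group_obj])
        then show ?thesis
          using le cl[of n] by (simp add: bond_mult bond_comp bond_closed monoid.m_assoc del: min.bounded_iff)
      qed
      then show ?thesis
        by (simp add: e seq_mult_def min.assoc fun_eq_iff)
    qed
    with s show ?thesis by (simp add: mult_asym_class seq_mult_closed)
  qed
  show "\<one>\<^bsub>?W\<^esub> \<otimes>\<^bsub>?W\<^esub> x = x" if "x \<in> carrier ?W" for x
  proof -
    from that obtain k g where s: "(k, g) \<in> asym_seqs G" "x = asym_class G p (k, g)"
      unfolding carrier_asym_limit by auto
    have "(seq_mult G p (\<lambda>n. n, \<lambda>n. \<one>\<^bsub>G n\<^esub>) (k, g), (k, g)) \<in> asym_rel G p"
      using s(1) seq_mult_closed[OF one_seq s(1)] unfolding seq_mult_def prod.case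
      by (intro asym_relI[where m = "\<lambda>n. min n (k n)"])
        (auto simp: asym_seqs_iff obj_simps monoid.l_one[OF group.is_monoid[OF group_obj]])
    from asym_class_eqI[OF this] show ?thesis
      by (simp add: s one mult_asym_class one_seq)
  qed
  show "\<exists>y\<in>carrier ?W. y \<otimes>\<^bsub>?W\<^esub> x = \<one>\<^bsub>?W\<^esub>" if "x \<in> carrier ?W" for x
  proof -
    from that obtain k g where s: "(k, g) \<in> asym_seqs G" "x = asym_class G p (k, g)"
      unfolding carrier_asym_limit by auto
    let ?i = "(k, \<lambda>n. inv\<^bsub>G (k n)\<^esub> g n)"
    have i: "?i \<in> asym_seqs G" using s(1) by (simp add: asym_seqs_iff obj_simps)
    have "(seq_mult G p ?i (k, g), (\<lambda>n. n, \<lambda>n. \<one>\<^bsub>G n\<^esub>)) \<in> asym_rel G p"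
      using s(1) seq_mult_closed[OF i s(1)] one_seq unfolding seq_mult_def prod.case
      by (intro asym_relI[where m = "\<lambda>n. min n (k n)"])
        (auto simp: asym_seqs_iff obj_simps group.l_inv[OF group_obj]
          intro!: filterlim_min_at_top_nat)
    from asym_class_eqI[OF this] have "asym_class G p ?i \<otimes>\<^bsub>?W\<^esub> x = \<one>\<^bsub>?W\<^esub>"
      by (simp add: s one mult_asym_class i)
    then show ?thesis using i unfolding carrier_asym_limit by blast
  qed
qed

lemma mono_representative:
  assumes "X \<in> carrier (asym_limit G p)"
  obtains k x where "mono k" "(k, x) \<in> asym_seqs G" "X = asym_class G p (k, x)"
proof -
  from assms obtain k g where s: "(k, g) \<in> asym_seqs G" "X = asym_class G p (k, g)"
    unfolding carrier_asym_limit by auto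
  obtain m where m: "mono m" "\<And>n. m n \<le> k n" "filterlim m at_top sequentially"
    using mono_minorant[of k] s(1) by (auto simp: asym_seqs_iff)
  let ?t = "(m, \<lambda>n. p (k n) (m n) (g n))"
  have t: "?t \<in> asym_seqs G" using s m by (simp add: asym_seqs_iff obj_simps)
  have "((k, g), ?t) \<in> asym_rel G p"
    using s t m by (intro asym_relI[where m = m]) (auto simp: asym_seqs_iff obj_simps)
  from asym_class_eqI[OF this] s(2) m(1) t show ?thesis by (intro that) auto
qed

lemma asym_shift_class:
  assumes s: "(k, x) \<in> asym_seqs G" and k: "mono k"
  shows "asym_shift G p (asym_class G p (k, x)) =
    asym_class G p
      (k, \<lambda>n. x n \<otimes>\<^bsub>G (k n)\<^esub> inv\<^bsub>G (k n)\<^esub> p (k (Suc n)) (k n) (x (Suc n)))"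
proof -
  define d :: "'a asym_seq \<Rightarrow> 'a asym_seq" where
    "d = (\<lambda>(k, x). (k, \<lambda>n. x n \<otimes>\<^bsub>G (k n)\<^esub> inv\<^bsub>G (k n)\<^esub> p (k (Suc n)) (k n) (x (Suc n))))"
  have seqs: "d (k, x) \<in> asym_seqs G" if "(k, x) \<in> asym_seqs G" "mono k" for k x
    using that by (simp add: d_def asym_seqs_iff obj_simps monoD)
  have *: "asym_class G p (d (l, y)) = asym_class G p (d (k, x))"
    if "(l, y) \<in> asym_class G p (k, x)" "mono l" for l y
  proof -
    from that have "((k, x), (l, y)) \<in> asym_rel G p" by (simp add: asym_class_def)
    then obtain m where t: "(l, y) \<in> asym_seqs G" and m: "mono m"
      "filterlim m at_top sequentially" "\<And>n. m n \<le> k n" "\<And>n. m n \<le> l n"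
      "\<forall>\<^sub>F n in sequentially. p (k n) (m n) (x n) = p (l n) (m n) (y n)"
      by (elim asym_relE) blast
    have cl: "x n \<in> carrier (G (k n))" "y n \<in> carrier (G (l n))" for n
      using s t by (auto simp: asym_seqs_iff)
    have "(d (k, x), d (l, y)) \<in> asym_rel G p"
      unfolding d_def prod.case
    proof (rule asym_relI[where m = m])
      show "\<forall>\<^sub>F n in sequentially.
        p (k n) (m n) (x n \<otimes>\<^bsub>G (k n)\<^esub> inv\<^bsub>G (k n)\<^esub> p (k (Suc n)) (k n) (x (Suc n))) =
        p (l n) (m n) (y n \<otimes>\<^bsub>G (l n)\<^esub> inv\<^bsub>G (l n)\<^esub> p (l (Suc n)) (l n) (y (Suc n)))"
        using m(5) m(5)[unfolded eventually_sequentially_Suc[symmetric,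
          of "\<lambda>n. p (k n) (m n) (x n) = p (l n) (m n) (y n)"]]
      proof eventually_elim
        case (elim n)
        have mm: "m n \<le> m (Suc n)" "k n \<le> k (Suc n)" "l n \<le> l (Suc n)"
          using m(1) k \<open>mono l\<close> by (auto simp: mono_iff_le_Suc)
        have "p (k (Suc n)) (m n) (x (Suc n)) = p (l (Suc n)) (m n) (y (Suc n))"
          using bond_comp[OF mm(1) m(3) cl(1)] bond_comp[OF mm(1) m(4) cl(2)] elim by simp
        then show ?case using elim m(3,4) mm cl by (simp add: obj_simps)
      qed
      show "(k, \<lambda>n. x n \<otimes>\<^bsub>G (k n)\<^esub> inv\<^bsub>G (k n)\<^esub> p (k (Suc n)) (k n) (x (Suc n))) \<in> asym_seqs G"
        using seqs[OF s k] by (simp add: d_def)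
      show "(l, \<lambda>n. y n \<otimes>\<^bsub>G (l n)\<^esub> inv\<^bsub>G (l n)\<^esub> p (l (Suc n)) (l n) (y (Suc n))) \<in> asym_seqs G"
        using seqs[OF t \<open>mono l\<close>] by (simp add: d_def)
    qed (use m in auto)
    from asym_class_eqI[OF this] show ?thesis by simp
  qed
  have "(\<Union>t\<in>{(l, y) \<in> asym_class G p (k, x). mono l}. asym_class G p (d t)) =
      asym_class G p (d (k, x))"
  proof (rule SUP_eq_const)
    show "{(l, y) \<in> asym_class G p (k, x). mono l} \<noteq> {}"
      using k asym_class_self[OF s] by blast
    show "asym_class G p (d t) = asym_class G p (d (k, x))"
      if "t \<in> {(l, y) \<in> asym_class G p (k, x). mono l}" for t
      using that *[of "fst t" "snd t"] by (simp add: case_prod_beta)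
  qed
  then show ?thesis by (simp add: asym_shift_def d_def case_prod_beta)
qed

end

context inverse_system_morphism
begin

lemma component_closed: "x \<in> carrier (G n) \<Longrightarrow> \<phi> n x \<in> carrier (H n)"
  using hom_component unfolding hom_def by blast

lemma component_mult:
  "\<lbrakk>x \<in> carrier (G n); y \<in> carrier (G n)\<rbrakk> \<Longrightarrow> \<phi> n (x \<otimes>\<^bsub>G n\<^esub> y) = \<phi> n x \<otimes>\<^bsub>H n\<^esub> \<phi> n y"
  using hom_component unfolding hom_def by blast

lemma asym_map_class:
  assumes s: "(k, g) \<in> asym_seqs G"
  shows "asym_map H q \<phi> (asym_class G p (k, g)) = asym_class H q (k, \<lambda>n. \<phi> (k n) (g n))"
proof -
  have *: "asym_class H q (l, \<lambda>n. \<phi> (l n) (h n)) = asym_class H q (k, \<lambda>n. \<phi> (k n) (g n))"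
    if "(l, h) \<in> asym_class G p (k, g)" for l h
  proof -
    from that have "((k, g), (l, h)) \<in> asym_rel G p" by (simp add: asym_class_def)
    then obtain m where t: "(l, h) \<in> asym_seqs G" and m:
      "filterlim m at_top sequentially" "\<And>n. m n \<le> k n" "\<And>n. m n \<le> l n"
      "\<forall>\<^sub>F n in sequentially. p (k n) (m n) (g n) = p (l n) (m n) (h n)"
      by (elim source.asym_relE) blast
    have "((k, \<lambda>n. \<phi> (k n) (g n)), (l, \<lambda>n. \<phi> (l n) (h n))) \<in> asym_rel H q"
    proof (rule target.asym_relI[where m = m])
      show "\<forall>\<^sub>F n in sequentially. q (k n) (m n) (\<phi> (k n) (g n)) = q (l n) (m n) (\<phi> (l n) (h n))"
        using m(4) by eventually_elim (use s t m in \<open>simp add: asym_seqs_iff commutes\<close>)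
    qed (use s t m in \<open>auto simp: asym_seqs_iff component_closed\<close>)
    from target.asym_class_eqI[OF this] show ?thesis by simp
  qed
  have "(\<Union>t\<in>asym_class G p (k, g). asym_class H q (fst t, \<lambda>n. \<phi> (fst t n) (snd t n))) =
      asym_class H q (fst (k, g), \<lambda>n. \<phi> (fst (k, g) n) (snd (k, g) n))"
  proof (rule SUP_eq_const)
    show "asym_class G p (k, g) \<noteq> {}"
      using source.asym_class_self[OF s] by blast
    show "asym_class H q (fst t, \<lambda>n. \<phi> (fst t n) (snd t n)) =
        asym_class H q (fst (k, g), \<lambda>n. \<phi> (fst (k, g) n) (snd (k, g) n))"
      if "t \<in> asym_class G p (k, g)" for t
      using that *[of "fst t" "snd t"] by simp
  qed
  then show ?thesis by (simp add: asym_map_def case_prod_beta)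
qed

lemma group_hom_asym_map: "group_hom (asym_limit G p) (asym_limit H q) (asym_map H q \<phi>)"
proof (intro group_hom.intro group_hom_axioms.intro source.group_asym_limit
    target.group_asym_limit homI)
  have cl: "(k, \<lambda>n. \<phi> (k n) (g n)) \<in> asym_seqs H" if "(k, g) \<in> asym_seqs G" for k g
    using that by (simp add: asym_seqs_iff component_closed)
  show "asym_map H q \<phi> X \<in> carrier (asym_limit H q)" if "X \<in> carrier (asym_limit G p)" for X
    using that cl unfolding source.carrier_asym_limit target.carrier_asym_limit
    by (auto simp: asym_map_class)
  show "asym_map H q \<phi> (X \<otimes>\<^bsub>asym_limit G p\<^esub> Y) =
      asym_map H q \<phi> X \<otimes>\<^bsub>asym_limit H q\<^esub> asym_map H q \<phi> Y"
    if XY: "X \<in> carrier (asym_limit G p)" "Y \<in> carrier (asym_limit G p)" for X Y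
  proof -
    from XY obtain k g l h where s: "(k, g) \<in> asym_seqs G" "(l, h) \<in> asym_seqs G"
      "X = asym_class G p (k, g)" "Y = asym_class G p (l, h)"
      unfolding source.carrier_asym_limit by auto
    have "(\<lambda>n. \<phi> (fst (seq_mult G p (k, g) (l, h)) n) (snd (seq_mult G p (k, g) (l, h)) n)) =
        snd (seq_mult H q (k, \<lambda>n. \<phi> (k n) (g n)) (l, \<lambda>n. \<phi> (l n) (h n)))"
      using s by (auto simp: seq_mult_def asym_seqs_iff component_mult commutes source.bond_closed)
    then show ?thesis
      using s asym_map_class[of "fst (seq_mult G p (k, g) (l, h))" "snd (seq_mult G p (k, g) (l, h))"]
        source.seq_mult_closed[OF s(1,2)]
      by (simp add: source.mult_asym_class target.mult_asym_class cl asym_map_class)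
        (simp add: seq_mult_def)
  qed
qed

end

lemma asym_map_id:
  assumes "inverse_system G p" and X: "X \<in> carrier (asym_limit G p)"
  shows "asym_map G p (\<lambda>n x. x) X = X"
proof -
  interpret G: inverse_system G p by fact
  interpret inverse_system_morphism G p G p "\<lambda>n x. x"
    by unfold_locales (auto simp: hom_def)
  show ?thesis using X unfolding G.carrier_asym_limit by (auto simp: asym_map_class)
qed

lemma asym_map_comp:
  assumes "inverse_system_morphism G p H q \<phi>" "inverse_system_morphism H q K r \<psi>"
    and X: "X \<in> carrier (asym_limit G p)"
  shows "asym_map K r (\<lambda>n x. \<psi> n (\<phi> n x)) X = asym_map K r \<psi> (asym_map H q \<phi> X)"
proof -
  interpret f: inverse_system_morphism G p H q \<phi> by fact
  interpret g: inverse_system_morphism H q K r \<psi> by fact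
  interpret gf: inverse_system_morphism G p K r "\<lambda>n x. \<psi> n (\<phi> n x)"
    by unfold_locales
      (simp_all add: hom_def Pi_iff f.component_closed f.component_mult g.component_closed
        g.component_mult g.commutes f.commutes)
  from X obtain k x where s: "(k, x) \<in> asym_seqs G" "X = asym_class G p (k, x)"
    unfolding f.source.carrier_asym_limit by auto
  then have "(k, \<lambda>n. \<phi> (k n) (x n)) \<in> asym_seqs H"
    by (simp add: asym_seqs_iff f.component_closed)
  with s show ?thesis
    by (simp add: f.asym_map_class g.asym_map_class gf.asym_map_class)
qed

end

theory Submission
  imports Defs
begin

text \<open>
  The idea is to look at an element of \<open>asym_limit G p\<close> one level at a time. Pushing a sequence
  \<open>g n \<in> G (k n)\<close> down to a fixed level \<open>j\<close> gives a sequence \<open>\<tau> j\<close> in \<open>G j\<close>, defined for all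
  large \<open>n\<close>, and the relation \<open>asym_rel\<close> turns out to be eventual equality at every level. In one
  direction this only projects further down; in the other, countably many eventual conditions can
  be met along one slowly growing diagonal (\<open>eventually_diagonal\<close>). The same diagonal argument
  shows that every family \<open>\<tau>\<close> which is compatible with the bonding maps at each level, for all
  large \<open>n\<close>, comes from an element (\<open>level_seqs_realize\<close>). Thus the asymptotic limit is the
  inverse limit over \<open>j\<close> of the groups \<open>G j ^ \<nat>\<close> modulo finitely supported sequences. In this
  description the group operations, induced maps and the shift are all computed levelwise.

  Exactness. Injectivity and the inclusion of the image in the kernel hold level by level. If an
  element of the kernel of \<open>\<psi>\<close> is given by \<open>\<upsilon>\<close>, then preimages of \<open>\<upsilon> j n\<close> under \<open>\<phi> j\<close> exist
  for large \<open>n\<close>, and they are compatible because \<open>\<phi> j\<close> is injective, so they form an element.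
  Surjectivity is a choice of preimages for the terms of one representing sequence.

  Triviality. Being pro-isomorphic to the trivial system means that every \<open>G j\<close> receives the
  trivial map from some later \<open>G m\<close>; then every \<open>\<tau> j\<close> is eventually trivial. If this fails at
  \<open>j\<close>, there are \<open>x n \<in> G n\<close> with nontrivial image in \<open>G j\<close> for all \<open>n \<ge> j\<close>. Sequences with
  terms \<open>x n\<close> or \<open>1\<close> are distinguished at level \<open>j\<close> as soon as they differ infinitely often, and
  there are uncountably many of them up to finite differences.

  The six-term sequence, written additively. At a fixed level the shift is \<open>\<tau> n \<mapsto> \<tau> n - \<tau> (n + 1)\<close>. Modulo finitely
  supported sequences it is surjective, with the constant sequences as its kernel. Compatible
  families of constants form the inverse limit, which identifies the kernel of the shift on the
  asymptotic limit. For the cokernel, solve \<open>\<tau> j n = \<sigma> j n - \<sigma> j (n + 1)\<close> at every level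
  separately. The family \<open>\<sigma>\<close> need not be compatible, but its defect
  \<open>\<sigma> j n - p (\<sigma> (j + 1) n)\<close> is eventually constant in \<open>n\<close>, with value \<open>z j\<close> say, and the map to
  the derived limit sends the given element to the class of \<open>z\<close>. The relation between elements
  \<open>X\<close> of the asymptotic limit and such \<open>z\<close> in the product of all \<open>G j\<close> (\<open>linked\<close>) is compatible
  with multiplication and inverses. Every \<open>X\<close> and every \<open>z\<close> occurs in it, the \<open>z\<close> related to
  \<open>X = 1\<close> form the image of \<open>lim_diff\<close>, and the \<open>X\<close> related to \<open>z = 1\<close> form the image of the
  shift. Hence it induces an isomorphism between the cokernels of the shift and of \<open>lim_diff\<close>.
\<close>

section \<open>Elements of the asymptotic limit, level by level\<close>

text \<open>
  Take \<open>m n\<close> to be the largest \<open>j \<le> n\<close> with \<open>P j n\<close>. It tends to infinity since each \<open>j\<close> is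
  eventually admissible.
\<close>

lemma eventually_diagonal:
  fixes P :: "nat \<Rightarrow> nat \<Rightarrow> bool"
  assumes "\<And>j. \<forall>\<^sub>F n in sequentially. P j n"
  obtains m where "filterlim m at_top sequentially" "\<forall>\<^sub>F n in sequentially. P (m n) n"
proof
  define S where "S n = {j. j \<le> n \<and> P j n}" for n
  define m where "m n = (if S n = {} then 0 else Max (S n))" for n
  have fin: "finite (S n)" for n unfolding S_def by simp
  show "filterlim m at_top sequentially"
    unfolding filterlim_at_top
  proof
    fix Z
    show "\<forall>\<^sub>F n in sequentially. Z \<le> m n"
      using assms[of Z] eventually_ge_at_top[of Z]
    proof eventually_elim
      case (elim n)
      then have "Z \<in> S n" by (simp add: S_def)
      then show ?case using fin[of n] by (auto simp: m_def)
    qed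
  qed
  show "\<forall>\<^sub>F n in sequentially. P (m n) n"
    using assms[of 0]
  proof eventually_elim
    case (elim n)
    then have "S n \<noteq> {}" by (auto simp: S_def)
    then have "m n \<in> S n" using Max_in[OF fin[of n]] by (simp add: m_def)
    then show ?case by (simp add: S_def)
  qed
qed

text \<open>
  The values \<open>p (k n) j (g n)\<close> are meaningful once \<open>k n \<ge> j\<close>, that is, for all large \<open>n\<close>. The
  family \<open>\<tau>\<close> is total, with arbitrary group elements in the remaining places, so that it can be
  manipulated without side conditions on \<open>n\<close>.
\<close>

definition level_seqs ::
  "(nat \<Rightarrow> 'a monoid) \<Rightarrow> (nat \<Rightarrow> nat \<Rightarrow> 'a \<Rightarrow> 'a) \<Rightarrow> 'a asym_seq set \<Rightarrow> (nat \<Rightarrow> nat \<Rightarrow> 'a) \<Rightarrow> bool"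
where
  "level_seqs G p X \<tau> \<longleftrightarrow>
    (\<forall>j n. \<tau> j n \<in> carrier (G j)) \<and>
    (\<exists>k g. (k, g) \<in> asym_seqs G \<and> X = asym_class G p (k, g) \<and>
       (\<forall>j. \<forall>\<^sub>F n in sequentially. p (k n) j (g n) = \<tau> j n))"

lemma level_seqs_closed: "level_seqs G p X \<tau> \<Longrightarrow> \<tau> j n \<in> carrier (G j)"
  by (simp add: level_seqs_def)

lemma asym_seqs_eventually_ge:
  "(k, g) \<in> asym_seqs G \<Longrightarrow> \<forall>\<^sub>F n in sequentially. j \<le> k n"
  by (simp add: asym_seqs_iff filterlim_at_top)

context inverse_system
begin

lemma asym_class_in_carrier: "s \<in> asym_seqs G \<Longrightarrow> asym_class G p s \<in> carrier (asym_limit G p)"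
  by (simp add: carrier_asym_limit)

lemma level_seqs_in_carrier: "level_seqs G p X \<tau> \<Longrightarrow> X \<in> carrier (asym_limit G p)"
  by (auto simp: level_seqs_def carrier_asym_limit)

text \<open>
  The index sequence \<open>m\<close> required by \<open>asym_rel\<close> is the diagonal of the levels at which the two
  sequences already agree.
\<close>

lemma asym_rel_iff_levels:
  assumes s: "(k, g) \<in> asym_seqs G" "(l, h) \<in> asym_seqs G"
  shows "((k, g), (l, h)) \<in> asym_rel G p \<longleftrightarrow>
    (\<forall>j. \<forall>\<^sub>F n in sequentially. p (k n) j (g n) = p (l n) j (h n))"
proof
  assume "((k, g), (l, h)) \<in> asym_rel G p"
  then obtain m where m: "filterlim m at_top sequentially" "\<And>n. m n \<le> k n" "\<And>n. m n \<le> l n"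
    "\<forall>\<^sub>F n in sequentially. p (k n) (m n) (g n) = p (l n) (m n) (h n)"
    by (elim asym_relE) blast
  show "\<forall>j. \<forall>\<^sub>F n in sequentially. p (k n) j (g n) = p (l n) j (h n)"
  proof
    fix j
    have "\<forall>\<^sub>F n in sequentially. j \<le> m n" using m(1) by (simp add: filterlim_at_top)
    with m(4) show "\<forall>\<^sub>F n in sequentially. p (k n) j (g n) = p (l n) j (h n)"
    proof eventually_elim
      case (elim n)
      then show ?case
        using bond_comp[of j "m n" "k n" "g n"] bond_comp[of j "m n" "l n" "h n"] m(2,3) s
        by (simp add: asym_seqs_iff)
    qed
  qed
next
  assume ev: "\<forall>j. \<forall>\<^sub>F n in sequentially. p (k n) j (g n) = p (l n) j (h n)"
  define P where "P j n \<longleftrightarrow> j \<le> k n \<and> j \<le> l n \<and> p (k n) j (g n) = p (l n) j (h n)" for j n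
  have P: "\<forall>\<^sub>F n in sequentially. P j n" for j
    using ev[rule_format, of j] asym_seqs_eventually_ge[OF s(1), of j]
      asym_seqs_eventually_ge[OF s(2), of j]
    by eventually_elim (simp add: P_def)
  obtain m where m: "filterlim m at_top sequentially" "\<forall>\<^sub>F n in sequentially. P (m n) n"
    using eventually_diagonal[of P, OF P] by blast
  \<comment> \<open>The bound on \<open>m\<close> in \<open>asym_rel\<close> is required at every \<open>n\<close>, not just for large \<open>n\<close>.\<close>
  define m' where "m' n = (if P (m n) n then m n else 0)" for n
  have "\<forall>\<^sub>F n in sequentially. m' n = m n"
    using m(2) by eventually_elim (simp add: m'_def)
  then have lim: "filterlim m' at_top sequentially"
    using m(1) filterlim_cong[OF refl refl, of m' m sequentially at_top] by blast
  show "((k, g), (l, h)) \<in> asym_rel G p"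
  proof (rule asym_relI[OF s lim])
    show "m' n \<le> k n" "m' n \<le> l n" for n by (auto simp: m'_def P_def)
    show "\<forall>\<^sub>F n in sequentially. p (k n) (m' n) (g n) = p (l n) (m' n) (h n)"
      using m(2) by eventually_elim (simp add: m'_def P_def)
  qed
qed

lemma asym_class_eq_iff_levels:
  assumes s: "(k, g) \<in> asym_seqs G" "(l, h) \<in> asym_seqs G"
  shows "asym_class G p (k, g) = asym_class G p (l, h) \<longleftrightarrow>
    (\<forall>j. \<forall>\<^sub>F n in sequentially. p (k n) j (g n) = p (l n) j (h n))"
  using eq_equiv_class_iff[OF equiv_asym_rel s] asym_rel_iff_levels[OF s]
  by (simp add: asym_class_def)

lemma level_seqs_asym_class_iff:
  assumes s: "(k, g) \<in> asym_seqs G"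
  shows "level_seqs G p (asym_class G p (k, g)) \<tau> \<longleftrightarrow>
    (\<forall>j n. \<tau> j n \<in> carrier (G j)) \<and>
    (\<forall>j. \<forall>\<^sub>F n in sequentially. p (k n) j (g n) = \<tau> j n)"
    (is "?L \<longleftrightarrow> ?R")
proof
  assume ?L
  then obtain l h where t: "(l, h) \<in> asym_seqs G" "asym_class G p (k, g) = asym_class G p (l, h)"
    and \<tau>: "\<And>j n. \<tau> j n \<in> carrier (G j)" "\<And>j. \<forall>\<^sub>F n in sequentially. p (l n) j (h n) = \<tau> j n"
    unfolding level_seqs_def by blast
  have "\<forall>\<^sub>F n in sequentially. p (k n) j (g n) = \<tau> j n" for j
    using t(2)[unfolded asym_class_eq_iff_levels[OF s t(1)], rule_format, of j] \<tau>(2)[of j]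
    by eventually_elim simp
  with \<tau> show ?R by blast
next
  assume ?R
  with s show ?L unfolding level_seqs_def by blast
qed

lemma level_seqs_exist:
  assumes "X \<in> carrier (asym_limit G p)"
  obtains \<tau> where "level_seqs G p X \<tau>"
proof -
  from assms obtain k g where s: "(k, g) \<in> asym_seqs G" "X = asym_class G p (k, g)"
    unfolding carrier_asym_limit by auto
  have "level_seqs G p X (\<lambda>j n. if j \<le> k n then p (k n) j (g n) else \<one>\<^bsub>G j\<^esub>)"
    unfolding s(2) level_seqs_asym_class_iff[OF s(1)]
  proof (intro conjI allI)
    show "(if j \<le> k n then p (k n) j (g n) else \<one>\<^bsub>G j\<^esub>) \<in> carrier (G j)" for j n
      using s(1) by (simp add: asym_seqs_iff obj_simps)
    show "\<forall>\<^sub>F n in sequentially.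
        p (k n) j (g n) = (if j \<le> k n then p (k n) j (g n) else \<one>\<^bsub>G j\<^esub>)" for j
      using asym_seqs_eventually_ge[OF s(1), of j] by eventually_elim simp
  qed
  then show ?thesis by (rule that)
qed

lemma level_seqs_unique:
  assumes "level_seqs G p X \<tau>" "level_seqs G p Y \<upsilon>"
    and "\<And>j. \<forall>\<^sub>F n in sequentially. \<tau> j n = \<upsilon> j n"
  shows "X = Y"
proof -
  obtain k g where s: "(k, g) \<in> asym_seqs G" "X = asym_class G p (k, g)"
      "\<And>j. \<forall>\<^sub>F n in sequentially. p (k n) j (g n) = \<tau> j n"
    using assms(1) unfolding level_seqs_def by blast
  obtain l h where t: "(l, h) \<in> asym_seqs G" "Y = asym_class G p (l, h)"
      "\<And>j. \<forall>\<^sub>F n in sequentially. p (l n) j (h n) = \<upsilon> j n"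
    using assms(2) unfolding level_seqs_def by blast
  have "\<forall>\<^sub>F n in sequentially. p (k n) j (g n) = p (l n) j (h n)" for j
    using assms(3)[of j] s(3)[of j] t(3)[of j] by eventually_elim simp
  then show ?thesis
    using asym_class_eq_iff_levels[OF s(1) t(1)] s(2) t(2) by simp
qed

lemma level_seqs_determined:
  assumes "level_seqs G p X \<tau>" "level_seqs G p X \<upsilon>"
  shows "\<forall>\<^sub>F n in sequentially. \<tau> j n = \<upsilon> j n"
proof -
  obtain k g where s: "(k, g) \<in> asym_seqs G" "X = asym_class G p (k, g)"
      "\<And>j. \<forall>\<^sub>F n in sequentially. p (k n) j (g n) = \<tau> j n"
    using assms(1) unfolding level_seqs_def by blast
  from assms(2)[unfolded s(2) level_seqs_asym_class_iff[OF s(1)]]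
  have "\<forall>\<^sub>F n in sequentially. p (k n) j (g n) = \<upsilon> j n" by blast
  with s(3)[of j] show ?thesis by eventually_elim simp
qed

lemma level_seqs_coherent:
  assumes "level_seqs G p X \<tau>" "j \<le> i"
  shows "\<forall>\<^sub>F n in sequentially. p i j (\<tau> i n) = \<tau> j n"
proof -
  obtain k g where s: "(k, g) \<in> asym_seqs G" "X = asym_class G p (k, g)"
      "\<And>j. \<forall>\<^sub>F n in sequentially. p (k n) j (g n) = \<tau> j n"
    using assms(1) unfolding level_seqs_def by blast
  show ?thesis
    using s(3)[of i] s(3)[of j] asym_seqs_eventually_ge[OF s(1), of i]
  proof eventually_elim
    case (elim n)
    have "g n \<in> carrier (G (k n))" using s(1) by (simp add: asym_seqs_iff)
    from bond_comp[OF assms(2) elim(3) this] elim show ?case by simp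
  qed
qed

text \<open>
  At time \<open>n\<close> use the entry \<open>\<tau> (k n) n\<close>, where \<open>k\<close> grows so slowly that the family is compatible
  at time \<open>n\<close> on all levels below \<open>k n\<close>.
\<close>

lemma level_seqs_realize:
  assumes cl: "\<And>j n. \<tau> j n \<in> carrier (G j)"
    and coh: "\<And>j. \<forall>\<^sub>F n in sequentially. p (Suc j) j (\<tau> (Suc j) n) = \<tau> j n"
  obtains X where "level_seqs G p X \<tau>"
proof -
  define P where "P K n \<longleftrightarrow> (\<forall>j<K. p (Suc j) j (\<tau> (Suc j) n) = \<tau> j n)" for K n
  have P: "\<forall>\<^sub>F n in sequentially. P K n" for K
    unfolding P_def using coh by (induction K) (auto simp: less_Suc_eq all_conj_distrib
      imp_conjL eventually_conj_iff elim: eventually_elim2)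
  obtain k where k: "filterlim k at_top sequentially" "\<forall>\<^sub>F n in sequentially. P (k n) n"
    using eventually_diagonal[of P, OF P] by blast
  have tower: "p K j (\<tau> K n) = \<tau> j n" if "P K n" "j \<le> K" for j K n
    using that
  proof (induction K)
    case 0
    then show ?case by (simp add: cl bond_id)
  next
    case (Suc K)
    show ?case
    proof (cases "j = Suc K")
      case True
      then show ?thesis by (simp add: cl bond_id)
    next
      case False
      then have "j \<le> K" "P K n" using Suc.prems by (auto simp: P_def)
      have "p (Suc K) j (\<tau> (Suc K) n) = p K j (p (Suc K) K (\<tau> (Suc K) n))"
        using \<open>j \<le> K\<close> by (simp add: bond_comp cl)
      also have "\<dots> = p K j (\<tau> K n)" using Suc.prems by (simp add: P_def)
      finally show ?thesis using Suc.IH \<open>j \<le> K\<close> \<open>P K n\<close> by simp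
    qed
  qed
  let ?s = "(k, \<lambda>n. \<tau> (k n) n)"
  have s: "?s \<in> asym_seqs G" using k cl by (simp add: asym_seqs_iff)
  have "level_seqs G p (asym_class G p ?s) \<tau>"
    unfolding level_seqs_asym_class_iff[OF s]
  proof (intro conjI allI)
    fix j
    show "\<forall>\<^sub>F n in sequentially. p (k n) j (\<tau> (k n) n) = \<tau> j n"
      using k(2) asym_seqs_eventually_ge[OF s, of j] by eventually_elim (rule tower)
  qed (rule cl)
  then show ?thesis by (rule that)
qed

lemma level_seqs_mult:
  assumes "level_seqs G p X \<tau>" "level_seqs G p Y \<upsilon>"
  shows "level_seqs G p (X \<otimes>\<^bsub>asym_limit G p\<^esub> Y) (\<lambda>j n. \<tau> j n \<otimes>\<^bsub>G j\<^esub> \<upsilon> j n)"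
proof -
  obtain k g where s: "(k, g) \<in> asym_seqs G" "X = asym_class G p (k, g)"
      "\<And>j. \<forall>\<^sub>F n in sequentially. p (k n) j (g n) = \<tau> j n"
    using assms(1) unfolding level_seqs_def by blast
  obtain l h where t: "(l, h) \<in> asym_seqs G" "Y = asym_class G p (l, h)"
      "\<And>j. \<forall>\<^sub>F n in sequentially. p (l n) j (h n) = \<upsilon> j n"
    using assms(2) unfolding level_seqs_def by blast
  define f where "f n = p (k n) (min (k n) (l n)) (g n)
      \<otimes>\<^bsub>G (min (k n) (l n))\<^esub> p (l n) (min (k n) (l n)) (h n)" for n
  have m: "seq_mult G p (k, g) (l, h) = (\<lambda>n. min (k n) (l n), f)"
    by (simp add: seq_mult_def f_def fun_eq_iff)
  have st: "(\<lambda>n. min (k n) (l n), f) \<in> asym_seqs G"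
    using seq_mult_closed[OF s(1) t(1)] by (simp add: m)
  have "level_seqs G p (asym_class G p (\<lambda>n. min (k n) (l n), f)) (\<lambda>j n. \<tau> j n \<otimes>\<^bsub>G j\<^esub> \<upsilon> j n)"
    unfolding level_seqs_asym_class_iff[OF st]
  proof (intro conjI allI)
    show "\<tau> j n \<otimes>\<^bsub>G j\<^esub> \<upsilon> j n \<in> carrier (G j)" for j n
      using assms by (simp add: level_seqs_closed obj_simps)
    show "\<forall>\<^sub>F n in sequentially. p (min (k n) (l n)) j (f n) = \<tau> j n \<otimes>\<^bsub>G j\<^esub> \<upsilon> j n" for j
      using s(3)[of j] t(3)[of j] asym_seqs_eventually_ge[OF s(1), of j]
        asym_seqs_eventually_ge[OF t(1), of j]
    proof eventually_elim
      case (elim n)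
      have "g n \<in> carrier (G (k n))" "h n \<in> carrier (G (l n))"
        using s(1) t(1) by (auto simp: asym_seqs_iff)
      with elim show ?case by (simp add: f_def obj_simps)
    qed
  qed
  then show ?thesis
    by (simp add: s(2) t(2) mult_asym_class[OF s(1) t(1)] m)
qed

lemma level_seqs_one: "level_seqs G p \<one>\<^bsub>asym_limit G p\<^esub> (\<lambda>j n. \<one>\<^bsub>G j\<^esub>)"
proof -
  have one: "\<one>\<^bsub>asym_limit G p\<^esub> = asym_class G p (\<lambda>n. n, \<lambda>n. \<one>\<^bsub>G n\<^esub>)"
    by (simp add: asym_limit_def)
  show ?thesis
    unfolding one level_seqs_asym_class_iff[OF one_seq]
  proof (intro conjI allI)
    show "\<forall>\<^sub>F n in sequentially. p n j \<one>\<^bsub>G n\<^esub> = \<one>\<^bsub>G j\<^esub>" for j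
      using eventually_ge_at_top[of j] by eventually_elim (rule bond_one)
  qed (simp add: obj_simps)
qed

lemma eq_one_iff_levels:
  assumes "level_seqs G p X \<tau>"
  shows "X = \<one>\<^bsub>asym_limit G p\<^esub> \<longleftrightarrow> (\<forall>j. \<forall>\<^sub>F n in sequentially. \<tau> j n = \<one>\<^bsub>G j\<^esub>)"
  using level_seqs_unique[OF assms level_seqs_one] level_seqs_determined[OF _ level_seqs_one] assms
  by metis

text \<open>
  The levelwise inverses are compatible, hence realized by some element, which is then the inverse.
\<close>

lemma level_seqs_inv:
  assumes "level_seqs G p X \<tau>"
  shows "level_seqs G p (inv\<^bsub>asym_limit G p\<^esub> X) (\<lambda>j n. inv\<^bsub>G j\<^esub> \<tau> j n)"
proof -
  let ?W = "asym_limit G p"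
  note cl = level_seqs_closed[OF assms]
  have "\<forall>\<^sub>F n in sequentially. p (Suc j) j (inv\<^bsub>G (Suc j)\<^esub> \<tau> (Suc j) n) = inv\<^bsub>G j\<^esub> \<tau> j n" for j
    using level_seqs_coherent[OF assms le_SucI[OF order_refl], of j]
    by eventually_elim (simp add: bond_inv cl)
  then obtain Y where Y: "level_seqs G p Y (\<lambda>j n. inv\<^bsub>G j\<^esub> \<tau> j n)"
    using level_seqs_realize[of "\<lambda>j n. inv\<^bsub>G j\<^esub> \<tau> j n"] cl by (auto simp: obj_simps)
  have "Y \<otimes>\<^bsub>?W\<^esub> X = \<one>\<^bsub>?W\<^esub>"
    using eq_one_iff_levels[OF level_seqs_mult[OF Y assms]]
    by (simp add: group.l_inv[OF group_obj] cl)
  with level_seqs_in_carrier[OF Y] level_seqs_in_carrier[OF assms] have "inv\<^bsub>?W\<^esub> X = Y"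
    by (intro group.inv_equality[OF group_asym_limit])
  with Y show ?thesis by simp
qed

end

lemma (in inverse_system_morphism) level_seqs_asym_map:
  assumes "level_seqs G p X \<tau>"
  shows "level_seqs H q (asym_map H q \<phi> X) (\<lambda>j n. \<phi> j (\<tau> j n))"
proof -
  obtain k g where s: "(k, g) \<in> asym_seqs G" "X = asym_class G p (k, g)"
      "\<And>j. \<forall>\<^sub>F n in sequentially. p (k n) j (g n) = \<tau> j n"
    using assms unfolding level_seqs_def by blast
  have t: "(k, \<lambda>n. \<phi> (k n) (g n)) \<in> asym_seqs H"
    using s(1) by (simp add: asym_seqs_iff component_closed)
  show ?thesis
    unfolding s(2) asym_map_class[OF s(1)] target.level_seqs_asym_class_iff[OF t]
  proof (intro conjI allI)
    show "\<phi> j (\<tau> j n) \<in> carrier (H j)" for j n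
      using level_seqs_closed[OF assms] by (simp add: component_closed)
    show "\<forall>\<^sub>F n in sequentially. q (k n) j (\<phi> (k n) (g n)) = \<phi> j (\<tau> j n)" for j
      using s(3)[of j] asym_seqs_eventually_ge[OF s(1), of j]
    proof eventually_elim
      case (elim n)
      then show ?case using s(1) by (simp add: asym_seqs_iff commutes)
    qed
  qed
qed

section \<open>Exactness\<close>

lemma short_exact_iff:
  "short_exact A f B g C \<longleftrightarrow>
    group_hom A B f \<and> group_hom B C g \<and>
    (\<forall>x \<in> carrier A. f x = \<one>\<^bsub>B\<^esub> \<longrightarrow> x = \<one>\<^bsub>A\<^esub>) \<and>
    f ` carrier A = kernel B C g \<and> g ` carrier B = carrier C"
proof -
  have 1: "exact_at (singleton_group ()) (\<lambda>_. \<one>\<^bsub>A\<^esub>) A f B \<longleftrightarrow>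
      group_hom A B f \<and> (\<forall>x \<in> carrier A. f x = \<one>\<^bsub>B\<^esub> \<longrightarrow> x = \<one>\<^bsub>A\<^esub>)"
  proof (cases "group_hom A B f")
    case True
    then interpret group_hom A B f .
    have "group_hom (singleton_group ()) A (\<lambda>_. \<one>\<^bsub>A\<^esub>)"
      by (intro group_hom.intro group_hom_axioms.intro) (auto simp: hom_def)
    then show ?thesis using True by (auto simp: exact_at_def kernel_def)
  qed (auto simp: exact_at_def)
  have 2: "exact_at B g C (\<lambda>_. ()) (singleton_group ()) \<longleftrightarrow>
      group_hom B C g \<and> g ` carrier B = carrier C"
  proof (cases "group_hom B C g")
    case True
    then interpret group_hom B C g .
    have "group_hom C (singleton_group ()) (\<lambda>_. ())"
      by (intro group_hom.intro group_hom_axioms.intro) (auto simp: hom_def)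
    then show ?thesis using True by (auto simp: exact_at_def kernel_def)
  qed (auto simp: exact_at_def)
  show ?thesis
    unfolding short_exact_def 1 2 by (auto simp: exact_at_def)
qed

theorem short_exact_asym_limit:
  assumes "inverse_system_morphism A a B b \<phi>" "inverse_system_morphism B b C c \<psi>"
    and exact: "\<And>n. short_exact (A n) (\<phi> n) (B n) (\<psi> n) (C n)"
  shows "short_exact (asym_limit A a) (asym_map B b \<phi>) (asym_limit B b)
    (asym_map C c \<psi>) (asym_limit C c)"
proof -
  interpret f: inverse_system_morphism A a B b \<phi> by fact
  interpret g: inverse_system_morphism B b C c \<psi> by fact
  have inj1: "x = \<one>\<^bsub>A n\<^esub>" if "x \<in> carrier (A n)" "\<phi> n x = \<one>\<^bsub>B n\<^esub>" for n x
    using exact[of n] that by (simp add: short_exact_iff)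
  have ker: "\<phi> n ` carrier (A n) = kernel (B n) (C n) (\<psi> n)" for n
    using exact[of n] by (simp add: short_exact_iff)
  have surj: "\<psi> n ` carrier (B n) = carrier (C n)" for n
    using exact[of n] by (simp add: short_exact_iff)
  have inj: "x = y" if "x \<in> carrier (A n)" "y \<in> carrier (A n)" "\<phi> n x = \<phi> n y" for n x y
  proof -
    interpret group_hom "A n" "B n" "\<phi> n" using exact[of n] by (simp add: short_exact_iff)
    have "inj_on (\<phi> n) (carrier (A n))" using inj1[of _ n] by (simp add: inj_on_one_iff)
    then show ?thesis using that by (simp add: inj_on_eq_iff)
  qed
  let ?f = "asym_map B b \<phi>" and ?g = "asym_map C c \<psi>"
  show ?thesis
    unfolding short_exact_iff
  proof (intro conjI ballI impI f.group_hom_asym_map g.group_hom_asym_map)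
    fix X assume X: "X \<in> carrier (asym_limit A a)" "?f X = \<one>\<^bsub>asym_limit B b\<^esub>"
    obtain \<tau> where \<tau>: "level_seqs A a X \<tau>" using f.source.level_seqs_exist[OF X(1)] .
    note cl = level_seqs_closed[OF \<tau>]
    have ev: "\<forall>\<^sub>F n in sequentially. \<phi> j (\<tau> j n) = \<one>\<^bsub>B j\<^esub>" for j
      using X(2) f.target.eq_one_iff_levels[OF f.level_seqs_asym_map[OF \<tau>]] by simp
    have "\<forall>\<^sub>F n in sequentially. \<tau> j n = \<one>\<^bsub>A j\<^esub>" for j
      using ev[of j] by eventually_elim (rule inj1[OF cl])
    then show "X = \<one>\<^bsub>asym_limit A a\<^esub>"
      using f.source.eq_one_iff_levels[OF \<tau>] by simp
  next
    show "?f ` carrier (asym_limit A a) = kernel (asym_limit B b) (asym_limit C c) ?g"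
    proof (intro equalityI subsetI)
      fix Y assume "Y \<in> ?f ` carrier (asym_limit A a)"
      then obtain X where X: "X \<in> carrier (asym_limit A a)" "Y = ?f X" by blast
      obtain \<tau> where \<tau>: "level_seqs A a X \<tau>" using f.source.level_seqs_exist[OF X(1)] .
      have Y: "level_seqs B b Y (\<lambda>j n. \<phi> j (\<tau> j n))"
        using f.level_seqs_asym_map[OF \<tau>] X(2) by simp
      have "\<psi> j (\<phi> j (\<tau> j n)) = \<one>\<^bsub>C j\<^esub>" for j n
        using ker[of j] level_seqs_closed[OF \<tau>, of j n] by (auto simp: kernel_def)
      then have "?g Y = \<one>\<^bsub>asym_limit C c\<^esub>"
        using g.target.eq_one_iff_levels[OF g.level_seqs_asym_map[OF Y]] by simp
      with f.target.level_seqs_in_carrier[OF Y]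
      show "Y \<in> kernel (asym_limit B b) (asym_limit C c) ?g" by (simp add: kernel_def)
    next
      fix Y assume "Y \<in> kernel (asym_limit B b) (asym_limit C c) ?g"
      then have Y: "Y \<in> carrier (asym_limit B b)" "?g Y = \<one>\<^bsub>asym_limit C c\<^esub>"
        by (auto simp: kernel_def)
      obtain \<upsilon> where \<upsilon>: "level_seqs B b Y \<upsilon>" using f.target.level_seqs_exist[OF Y(1)] .
      have ev: "\<forall>\<^sub>F n in sequentially. \<psi> j (\<upsilon> j n) = \<one>\<^bsub>C j\<^esub>" for j
        using Y(2) g.target.eq_one_iff_levels[OF g.level_seqs_asym_map[OF \<upsilon>]] by simp
      \<comment> \<open>For small \<open>n\<close> there may be no preimage; any group element will do there.\<close>
      define \<tau> where "\<tau> j n = (if \<psi> j (\<upsilon> j n) = \<one>\<^bsub>C j\<^esub>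
        then SOME x. x \<in> carrier (A j) \<and> \<phi> j x = \<upsilon> j n else \<one>\<^bsub>A j\<^esub>)" for j n
      have \<tau>: "\<tau> j n \<in> carrier (A j) \<and> \<phi> j (\<tau> j n) = \<upsilon> j n"
        if "\<psi> j (\<upsilon> j n) = \<one>\<^bsub>C j\<^esub>" for j n
      proof -
        have "\<upsilon> j n \<in> \<phi> j ` carrier (A j)"
          unfolding ker using that level_seqs_closed[OF \<upsilon>] by (simp add: kernel_def)
        then have "\<exists>x. x \<in> carrier (A j) \<and> \<phi> j x = \<upsilon> j n" by auto
        from someI_ex[OF this] show ?thesis using that by (simp add: \<tau>_def)
      qed
      have cl: "\<tau> j n \<in> carrier (A j)" for j n
        using \<tau>[of j n] by (cases "\<psi> j (\<upsilon> j n) = \<one>\<^bsub>C j\<^esub>")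
          (auto simp: \<tau>_def f.source.obj_simps)
      have "\<forall>\<^sub>F n in sequentially. a (Suc j) j (\<tau> (Suc j) n) = \<tau> j n" for j
        using ev[of j] ev[of "Suc j"] f.target.level_seqs_coherent[OF \<upsilon> le_SucI[OF order_refl], of j]
      proof eventually_elim
        case (elim n)
        have "\<phi> j (a (Suc j) j (\<tau> (Suc j) n)) = b (Suc j) j (\<phi> (Suc j) (\<tau> (Suc j) n))"
          by (simp add: f.commutes cl)
        also have "\<dots> = \<phi> j (\<tau> j n)" using elim \<tau> by simp
        finally show ?case by (intro inj[where n = j] cl f.source.bond_closed) simp
      qed
      then obtain X where X: "level_seqs A a X \<tau>"
        using f.source.level_seqs_realize[of \<tau>] cl by blast
      have "?f X = Y"
      proof (rule f.target.level_seqs_unique[OF f.level_seqs_asym_map[OF X] \<upsilon>])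
        show "\<forall>\<^sub>F n in sequentially. \<phi> j (\<tau> j n) = \<upsilon> j n" for j
          using ev[of j] by eventually_elim (simp add: \<tau>)
      qed
      then show "Y \<in> ?f ` carrier (asym_limit A a)"
        using f.source.level_seqs_in_carrier[OF X] by blast
    qed
  next
    interpret gh: group_hom "asym_limit B b" "asym_limit C c" ?g by (rule g.group_hom_asym_map)
    show "?g ` carrier (asym_limit B b) = carrier (asym_limit C c)"
    proof (intro equalityI subsetI)
      fix Z assume "Z \<in> carrier (asym_limit C c)"
      then obtain k z where s: "(k, z) \<in> asym_seqs C" "Z = asym_class C c (k, z)"
        unfolding g.target.carrier_asym_limit by auto
      have "\<forall>n. \<exists>y. y \<in> carrier (B (k n)) \<and> \<psi> (k n) y = z n"
      proof
        fix n
        have "z n \<in> \<psi> (k n) ` carrier (B (k n))"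
          unfolding surj using s(1) by (simp add: asym_seqs_iff)
        then show "\<exists>y. y \<in> carrier (B (k n)) \<and> \<psi> (k n) y = z n" by auto
      qed
      then obtain y where y: "\<And>n. y n \<in> carrier (B (k n))" "\<And>n. \<psi> (k n) (y n) = z n"
        by metis
      have t: "(k, y) \<in> asym_seqs B" using s(1) y(1) by (simp add: asym_seqs_iff)
      have "?g (asym_class B b (k, y)) = Z" by (simp add: g.asym_map_class[OF t] y(2) s(2))
      with f.target.asym_class_in_carrier[OF t] show "Z \<in> ?g ` carrier (asym_limit B b)" by blast
    qed auto
  qed
qed

section \<open>Triviality and uncountability\<close>

text \<open>
  A bonding map that factors through the trivial group is trivial. Conversely, choosing indices
  such that all consecutive bonding maps are trivial gives the interlacing maps.
\<close>

lemma (in inverse_system) pro_isomorphic_trivial_iff: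
  "pro_isomorphic G p trivial_system trivial_bond \<longleftrightarrow>
    (\<forall>n. \<exists>m\<ge>n. \<forall>x \<in> carrier (G m). p m n x = \<one>\<^bsub>G n\<^esub>)"
proof
  assume "pro_isomorphic G p trivial_system trivial_bond"
  then obtain i \<alpha> \<beta> where i: "strict_mono (i :: nat \<Rightarrow> nat)"
    and \<beta>: "\<And>n. \<beta> n \<in> hom (singleton_group ()) (G (i n))"
    and \<beta>\<alpha>: "\<And>n x. x \<in> carrier (G (i (Suc n))) \<Longrightarrow> \<beta> n (\<alpha> n x :: unit) = p (i (Suc n)) (i n) x"
    unfolding pro_isomorphic_def trivial_system_def by blast
  show "\<forall>n. \<exists>m\<ge>n. \<forall>x \<in> carrier (G m). p m n x = \<one>\<^bsub>G n\<^esub>"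
  proof
    fix n
    have le: "n \<le> i n" "i n \<le> i (Suc n)"
      using strict_mono_imp_increasing[OF i] strict_mono_less_eq[OF i] by simp_all
    show "\<exists>m\<ge>n. \<forall>x \<in> carrier (G m). p m n x = \<one>\<^bsub>G n\<^esub>"
    proof (intro exI conjI ballI)
      show "n \<le> i (Suc n)" using le by simp
      fix x assume x: "x \<in> carrier (G (i (Suc n)))"
      have "group_hom (singleton_group ()) (G (i n)) (\<beta> n)"
        by (intro group_hom.intro group_hom_axioms.intro group_obj \<beta>) simp
      from group_hom.hom_one[OF this] have "\<beta> n () = \<one>\<^bsub>G (i n)\<^esub>"
        by (simp add: singleton_group_def)
      with \<beta>\<alpha>[OF x] have "p (i (Suc n)) (i n) x = \<one>\<^bsub>G (i n)\<^esub>" by simp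
      with bond_comp[OF le x] le(1) show "p (i (Suc n)) n x = \<one>\<^bsub>G n\<^esub>" by (simp add: bond_one)
    qed
  qed
next
  assume null: "\<forall>n. \<exists>m\<ge>n. \<forall>x \<in> carrier (G m). p m n x = \<one>\<^bsub>G n\<^esub>"
  have step: "\<exists>m>n. \<forall>x \<in> carrier (G m). p m n x = \<one>\<^bsub>G n\<^esub>" for n
  proof -
    from null obtain m where m: "m \<ge> n" "\<And>x. x \<in> carrier (G m) \<Longrightarrow> p m n x = \<one>\<^bsub>G n\<^esub>" by blast
    have "p (Suc m) n x = \<one>\<^bsub>G n\<^esub>" if "x \<in> carrier (G (Suc m))" for x
    proof -
      have "p (Suc m) n x = p m n (p (Suc m) m x)" using m(1) that by (simp add: bond_comp)
      also have "\<dots> = \<one>\<^bsub>G n\<^esub>" by (intro m(2) bond_closed that) simp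
      finally show ?thesis .
    qed
    then show ?thesis using m(1) by (intro exI[of _ "Suc m"]) auto
  qed
  obtain i where
    "\<forall>n. i n < i (Suc n) \<and> (\<forall>x \<in> carrier (G (i (Suc n))). p (i (Suc n)) (i n) x = \<one>\<^bsub>G (i n)\<^esub>)"
    using dependent_nat_choice[of "\<lambda>_ _. True" "\<lambda>_ n m. m > n \<and> (\<forall>x \<in> carrier (G m). p m n x = \<one>\<^bsub>G n\<^esub>)"]
      step by auto
  then have i: "\<And>n. i n < i (Suc n)"
      "\<And>n x. x \<in> carrier (G (i (Suc n))) \<Longrightarrow> p (i (Suc n)) (i n) x = \<one>\<^bsub>G (i n)\<^esub>"
    by blast+
  show "pro_isomorphic G p trivial_system trivial_bond"
    unfolding pro_isomorphic_def
  proof (intro exI conjI allI ballI)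
    show "strict_mono i" using i(1) by (simp add: strict_mono_Suc_iff)
    show "strict_mono (\<lambda>n::nat. n)" by (simp add: strict_mono_def)
    show "(\<lambda>_. ()) \<in> hom (G (i (Suc n))) (trivial_system n)" for n
      by (simp add: trivial_system_def hom_def singleton_group_def)
    show "(\<lambda>_. \<one>\<^bsub>G (i n)\<^esub>) \<in> hom (trivial_system n) (G (i n))" for n
      by (simp add: trivial_system_def hom_def obj_simps monoid.l_one[OF group.is_monoid[OF group_obj]])
  qed (use i(2) in \<open>simp_all add: trivial_bond_def\<close>)
qed

lemma (in inverse_system) asym_limit_trivial:
  assumes "pro_isomorphic G p trivial_system trivial_bond"
  shows "trivial_group (asym_limit G p)"
proof -
  interpret W: group "asym_limit G p" by (rule group_asym_limit)
  have "X = \<one>\<^bsub>asym_limit G p\<^esub>" if X: "X \<in> carrier (asym_limit G p)" for X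
  proof -
    obtain \<tau> where \<tau>: "level_seqs G p X \<tau>" using level_seqs_exist[OF X] .
    have "\<forall>\<^sub>F n in sequentially. \<tau> j n = \<one>\<^bsub>G j\<^esub>" for j
    proof -
      obtain m where m: "m \<ge> j" "\<And>x. x \<in> carrier (G m) \<Longrightarrow> p m j x = \<one>\<^bsub>G j\<^esub>"
        using assms[unfolded pro_isomorphic_trivial_iff] by blast
      show ?thesis
        using level_seqs_coherent[OF \<tau> m(1)]
        by eventually_elim (use m(2) level_seqs_closed[OF \<tau>] in metis)
    qed
    then show ?thesis using eq_one_iff_levels[OF \<tau>] by simp
  qed
  then show ?thesis by (auto simp: W.trivial_group_subset)
qed

lemma (in inverse_system) asym_limit_uncountable:
  assumes "\<not> pro_isomorphic G p trivial_system trivial_bond"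
  shows "uncountable (carrier (asym_limit G p))"
proof
  assume cnt: "countable (carrier (asym_limit G p))"
  obtain j where j: "\<And>m. m \<ge> j \<Longrightarrow> \<exists>x \<in> carrier (G m). p m j x \<noteq> \<one>\<^bsub>G j\<^esub>"
    using assms unfolding pro_isomorphic_trivial_iff by blast
  define x where "x m = (SOME x. x \<in> carrier (G m) \<and> p m j x \<noteq> \<one>\<^bsub>G j\<^esub>)" for m
  have x: "x m \<in> carrier (G m)" "p m j (x m) \<noteq> \<one>\<^bsub>G j\<^esub>" if "m \<ge> j" for m
  proof -
    from j[OF that] have "\<exists>y. y \<in> carrier (G m) \<and> p m j y \<noteq> \<one>\<^bsub>G j\<^esub>" by blast
    from someI_ex[OF this] show "x m \<in> carrier (G m)" "p m j (x m) \<noteq> \<one>\<^bsub>G j\<^esub>"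
      unfolding x_def by auto
  qed
  \<comment> \<open>Reading \<open>n\<close> as a pair repeats each \<open>i\<close> infinitely often, so different sets give sequences
    that differ infinitely often.\<close>
  define g where "g S n = (if j \<le> n \<and> fst (prod_decode n) \<in> S then x n else \<one>\<^bsub>G n\<^esub>)"
    for S :: "nat set" and n
  have s: "(\<lambda>n. n, g S) \<in> asym_seqs G" for S
    by (auto simp: asym_seqs_iff g_def x obj_simps filterlim_ident)
  let ?c = "\<lambda>S. asym_class G p (\<lambda>n. n, g S)"
  have sub: "S \<subseteq> T" if eq: "?c S = ?c T" for S T
  proof
    fix i assume i: "i \<in> S"
    have "\<forall>\<^sub>F n in sequentially. p n j (g S n) = p n j (g T n)"
      using eq asym_class_eq_iff_levels[OF s s] by blast
    then obtain N where N: "\<And>n. n \<ge> N \<Longrightarrow> p n j (g S n) = p n j (g T n)"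
      unfolding eventually_sequentially by blast
    \<comment> \<open>A time at which the two sequences agree at level \<open>j\<close> and \<open>i\<close> is tested.\<close>
    let ?n = "prod_encode (i, max j N)"
    have n: "?n \<ge> j" "?n \<ge> N" using le_prod_encode_2[of "max j N" i] by auto
    show "i \<in> T"
      using N[OF n(2)] n(1) i x(2)[OF n(1)] by (auto simp: g_def bond_one split: if_splits)
  qed
  have "inj ?c" using sub by (intro injI) blast
  moreover have "countable (range ?c)"
    using cnt by (rule countable_subset[rotated]) (auto intro: asym_class_in_carrier s)
  ultimately have "countable (UNIV :: nat set set)" by (rule countable_image_inj_on[rotated])
  then obtain f :: "nat set \<Rightarrow> nat" where "inj f" unfolding countable_def by blast
  then have "surj (inv_into UNIV f)" by (rule inj_imp_surj_inv)
  then show False using Cantors_theorem[of "UNIV :: nat set"] by auto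
qed

section \<open>The shift operator and the derived limits\<close>

lemma eventually_constant:
  fixes f :: "nat \<Rightarrow> 'a"
  assumes "\<forall>\<^sub>F n in sequentially. f n = f (Suc n)"
  obtains c where "c \<in> range f" "\<forall>\<^sub>F n in sequentially. c = f n"
proof -
  from assms obtain N where N: "\<And>n. n \<ge> N \<Longrightarrow> f n = f (Suc n)"
    unfolding eventually_sequentially by blast
  have "f N = f n" if "n \<ge> N" for n
    using that by (induction rule: dec_induct) (use N in \<open>metis+\<close>)
  then show ?thesis by (intro that[of "f N"]) (auto simp: eventually_sequentially)
qed

lemma (in comm_group) mult_quotients:
  assumes "x \<in> carrier G" "y \<in> carrier G" "z \<in> carrier G" "w \<in> carrier G"
  shows "x \<otimes> y \<otimes> inv (z \<otimes> w) = (x \<otimes> inv z) \<otimes> (y \<otimes> inv w)"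
  using assms by (simp add: inv_mult m_ac)

lemma (in comm_group) inv_quotient:
  assumes "x \<in> carrier G" "z \<in> carrier G"
  shows "inv x \<otimes> inv (inv z) = inv (x \<otimes> inv z)"
  using assms by (simp add: inv_mult)

lemma (in comm_group) quotient_cancel_right:
  assumes "x \<in> carrier G" "y \<in> carrier G" "z \<in> carrier G"
  shows "(x \<otimes> z) \<otimes> inv (y \<otimes> z) = x \<otimes> inv y"
  using mult_quotients[of x z y z] assms by simp

lemma (in group) quotient_eq_one_iff:
  assumes "x \<in> carrier G" "y \<in> carrier G"
  shows "x \<otimes> inv y = \<one> \<longleftrightarrow> x = y"
  using assms inv_solve_right'[of \<one> x y] by auto

locale abelian_inverse_system = inverse_system +
  assumes comm: "comm_group (G n)"
begin

abbreviation W where "W \<equiv> asym_limit G p"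
abbreviation P where "P \<equiv> product_group UNIV G"
abbreviation \<Delta> where "\<Delta> \<equiv> lim_diff G p"
abbreviation \<Phi> where "\<Phi> \<equiv> asym_shift G p"

text \<open>
  Projecting a monotone representative of \<open>X\<close> to level \<open>j\<close> turns the bonding maps in the
  definition of the shift into the plain index shift, since
  \<open>p (k (Suc n)) (k n)\<close> followed by \<open>p (k n) j\<close> is \<open>p (k (Suc n)) j\<close>.
\<close>

lemma level_seqs_shift:
  assumes "level_seqs G p X \<tau>"
  shows "level_seqs G p (\<Phi> X) (\<lambda>j n. \<tau> j n \<otimes>\<^bsub>G j\<^esub> inv\<^bsub>G j\<^esub> \<tau> j (Suc n))"
proof -
  obtain k x where k: "mono k" and s: "(k, x) \<in> asym_seqs G" "X = asym_class G p (k, x)"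
    using mono_representative[OF level_seqs_in_carrier[OF assms]] .
  note lev = assms[unfolded s(2) level_seqs_asym_class_iff[OF s(1)]]
  have cl: "x n \<in> carrier (G (k n))" "k n \<le> k (Suc n)" for n
    using s(1) k by (auto simp: asym_seqs_iff monoD)
  define y where "y n = x n \<otimes>\<^bsub>G (k n)\<^esub> inv\<^bsub>G (k n)\<^esub> p (k (Suc n)) (k n) (x (Suc n))" for n
  have t: "(k, y) \<in> asym_seqs G"
    using s(1) cl by (simp add: asym_seqs_iff y_def obj_simps)
  have "level_seqs G p (asym_class G p (k, y)) (\<lambda>j n. \<tau> j n \<otimes>\<^bsub>G j\<^esub> inv\<^bsub>G j\<^esub> \<tau> j (Suc n))"
    unfolding level_seqs_asym_class_iff[OF t]
  proof (intro conjI allI)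
    show "\<tau> j n \<otimes>\<^bsub>G j\<^esub> inv\<^bsub>G j\<^esub> \<tau> j (Suc n) \<in> carrier (G j)" for j n
      using lev by (simp add: obj_simps)
    fix j
    have 1: "\<forall>\<^sub>F n in sequentially. p (k n) j (x n) = \<tau> j n" using lev by blast
    then have 2: "\<forall>\<^sub>F n in sequentially. p (k (Suc n)) j (x (Suc n)) = \<tau> j (Suc n)"
      by (subst eventually_sequentially_Suc)
    show "\<forall>\<^sub>F n in sequentially. p (k n) j (y n) = \<tau> j n \<otimes>\<^bsub>G j\<^esub> inv\<^bsub>G j\<^esub> \<tau> j (Suc n)"
      using 1 2 asym_seqs_eventually_ge[OF s(1), of j]
      by eventually_elim (simp add: y_def obj_simps cl)
  qed
  then show ?thesis
    unfolding s(2) asym_shift_class[OF s(1) k] y_def .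
qed

lemma group_hom_shift: "group_hom W W \<Phi>"
proof (intro group_hom.intro group_hom_axioms.intro group_asym_limit homI)
  show "\<Phi> X \<in> carrier W" if X: "X \<in> carrier W" for X
    using level_seqs_exist[OF X] level_seqs_in_carrier[OF level_seqs_shift] by metis
  show "\<Phi> (X \<otimes>\<^bsub>W\<^esub> Y) = \<Phi> X \<otimes>\<^bsub>W\<^esub> \<Phi> Y" if XY: "X \<in> carrier W" "Y \<in> carrier W" for X Y
  proof -
    obtain \<tau> \<upsilon> where \<tau>: "level_seqs G p X \<tau>" and \<upsilon>: "level_seqs G p Y \<upsilon>"
      using level_seqs_exist XY by metis
    show ?thesis
      by (rule level_seqs_unique[OF level_seqs_shift[OF level_seqs_mult[OF \<tau> \<upsilon>]]
            level_seqs_mult[OF level_seqs_shift[OF \<tau>] level_seqs_shift[OF \<upsilon>]]])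
        (simp add: comm_group.mult_quotients[OF comm] level_seqs_closed[OF \<tau>] level_seqs_closed[OF \<upsilon>])
  qed
qed

lemma comm_group_product: "comm_group P"
proof (rule group.group_comm_groupI)
  show "group P" by (simp add: group_obj)
  show "x \<otimes>\<^bsub>P\<^esub> y = y \<otimes>\<^bsub>P\<^esub> x" if "x \<in> carrier P" "y \<in> carrier P" for x y
    using that comm by (auto simp: fun_eq_iff PiE_iff comm_groupE(4))
qed

lemma in_product_iff: "x \<in> carrier P \<longleftrightarrow> (\<forall>n. x n \<in> carrier (G n))"
  by (auto simp: PiE_iff)

lemma group_hom_lim_diff: "group_hom P P \<Delta>"
proof (intro group_hom.intro group_hom_axioms.intro homI)
  show "group P" "group P" by (simp_all add: group_obj)
  show "\<Delta> x \<in> carrier P" if "x \<in> carrier P" for x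
    using that unfolding in_product_iff by (simp add: lim_diff_def obj_simps)
  show "\<Delta> (x \<otimes>\<^bsub>P\<^esub> y) = \<Delta> x \<otimes>\<^bsub>P\<^esub> \<Delta> y" if "x \<in> carrier P" "y \<in> carrier P" for x y
    using that unfolding in_product_iff
    by (simp add: lim_diff_def fun_eq_iff obj_simps comm_group.mult_quotients[OF comm])
qed

lemma in_inv_limit_iff:
  "x \<in> carrier (inv_limit G p) \<longleftrightarrow>
    (\<forall>n. x n \<in> carrier (G n)) \<and> (\<forall>n. p (Suc n) n (x (Suc n)) = x n)"
proof -
  have "x n \<otimes>\<^bsub>G n\<^esub> inv\<^bsub>G n\<^esub> p (Suc n) n (x (Suc n)) = \<one>\<^bsub>G n\<^esub> \<longleftrightarrow> p (Suc n) n (x (Suc n)) = x n"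
    if "\<forall>n. x n \<in> carrier (G n)" for n
    using group.quotient_eq_one_iff[OF group_obj, of "x n" n "p (Suc n) n (x (Suc n))"] that
    by (auto simp: bond_closed)
  then show ?thesis
    unfolding inv_limit_def by (auto simp: kernel_def lim_diff_def fun_eq_iff PiE_iff)
qed

lemma group_inv_limit: "group (inv_limit G p)"
proof -
  interpret D: group_hom P P \<Delta> by (rule group_hom_lim_diff)
  show ?thesis
    unfolding inv_limit_def by (rule subgroup.subgroup_is_group[OF D.subgroup_kernel D.G.is_group])
qed

definition constant_class :: "(nat \<Rightarrow> 'a) \<Rightarrow> 'a asym_seq set" where
  "constant_class x = asym_class G p (\<lambda>n. n, x)"

lemma level_seqs_constant_class:
  assumes "x \<in> carrier (inv_limit G p)"
  shows "level_seqs G p (constant_class x) (\<lambda>j n. x j)"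
proof -
  have cl: "x n \<in> carrier (G n)" and step: "p (Suc n) n (x (Suc n)) = x n" for n
    using assms by (auto simp: in_inv_limit_iff)
  have s: "(\<lambda>n. n, x) \<in> asym_seqs G" by (simp add: asym_seqs_iff cl filterlim_ident)
  have tower: "p n j (x n) = x j" if "j \<le> n" for j n
    using that
  proof (induction rule: dec_induct)
    case base
    show ?case by (simp add: bond_id cl)
  next
    case (step n)
    then show ?case
      using bond_comp[of j n "Suc n" "x (Suc n)"] cl \<open>p (Suc n) n (x (Suc n)) = x n\<close> by simp
  qed
  show ?thesis
    unfolding constant_class_def level_seqs_asym_class_iff[OF s]
  proof (intro conjI allI cl)
    show "\<forall>\<^sub>F n in sequentially. p n j (x n) = x j" for j
      using eventually_ge_at_top[of j] by eventually_elim (rule tower)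
  qed
qed

lemma group_hom_constant_class: "group_hom (inv_limit G p) W constant_class"
proof (intro group_hom.intro group_hom_axioms.intro group_inv_limit group_asym_limit homI)
  show "constant_class x \<in> carrier W" if "x \<in> carrier (inv_limit G p)" for x
    using level_seqs_in_carrier[OF level_seqs_constant_class[OF that]] .
  show "constant_class (x \<otimes>\<^bsub>inv_limit G p\<^esub> y) = constant_class x \<otimes>\<^bsub>W\<^esub> constant_class y"
    if xy: "x \<in> carrier (inv_limit G p)" "y \<in> carrier (inv_limit G p)" for x y
  proof (rule level_seqs_unique)
    show "level_seqs G p (constant_class (x \<otimes>\<^bsub>inv_limit G p\<^esub> y)) (\<lambda>j n. (x \<otimes>\<^bsub>inv_limit G p\<^esub> y) j)"
      using xy by (intro level_seqs_constant_class monoid.m_closed group.is_monoid group_inv_limit)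
    show "level_seqs G p (constant_class x \<otimes>\<^bsub>W\<^esub> constant_class y) (\<lambda>j n. x j \<otimes>\<^bsub>G j\<^esub> y j)"
      using xy by (intro level_seqs_mult level_seqs_constant_class)
  qed (simp add: inv_limit_def)
qed

lemma constant_class_eq_one:
  assumes "x \<in> carrier (inv_limit G p)" "constant_class x = \<one>\<^bsub>W\<^esub>"
  shows "x = \<one>\<^bsub>inv_limit G p\<^esub>"
proof -
  have "\<forall>\<^sub>F n in sequentially. x j = \<one>\<^bsub>G j\<^esub>" for j
    using assms eq_one_iff_levels[OF level_seqs_constant_class[OF assms(1)]] by simp
  then show ?thesis by (simp add: inv_limit_def fun_eq_iff)
qed

text \<open>
  An element killed by the shift has eventually constant level sequences. Their limits are
  compatible, and the element is the class of the thread that they form.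
\<close>

lemma kernel_shift: "kernel W W \<Phi> = constant_class ` carrier (inv_limit G p)"
proof (intro equalityI subsetI)
  fix X assume "X \<in> constant_class ` carrier (inv_limit G p)"
  then obtain x where x: "x \<in> carrier (inv_limit G p)" "X = constant_class x" by blast
  have X: "level_seqs G p X (\<lambda>j n. x j)" using level_seqs_constant_class x by simp
  have "\<Phi> X = \<one>\<^bsub>W\<^esub>"
    using eq_one_iff_levels[OF level_seqs_shift[OF X]] level_seqs_closed[OF X]
    by (simp add: group.r_inv[OF group_obj])
  then show "X \<in> kernel W W \<Phi>" using level_seqs_in_carrier[OF X] by (simp add: kernel_def)
next
  fix X assume "X \<in> kernel W W \<Phi>"
  then have X: "X \<in> carrier W" "\<Phi> X = \<one>\<^bsub>W\<^esub>" by (auto simp: kernel_def)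
  obtain \<tau> where \<tau>: "level_seqs G p X \<tau>" using level_seqs_exist[OF X(1)] .
  note cl = level_seqs_closed[OF \<tau>]
  have "\<forall>\<^sub>F n in sequentially. \<tau> j n \<otimes>\<^bsub>G j\<^esub> inv\<^bsub>G j\<^esub> \<tau> j (Suc n) = \<one>\<^bsub>G j\<^esub>" for j
    using X(2) eq_one_iff_levels[OF level_seqs_shift[OF \<tau>]] by simp
  then have "\<forall>\<^sub>F n in sequentially. \<tau> j n = \<tau> j (Suc n)" for j
    by (simp add: group.quotient_eq_one_iff[OF group_obj] cl)
  then have "\<exists>c. c \<in> range (\<tau> j) \<and> (\<forall>\<^sub>F n in sequentially. c = \<tau> j n)" for j
    using eventually_constant[of "\<tau> j"] by blast
  then obtain x where x: "\<And>j. x j \<in> range (\<tau> j)" "\<And>j. \<forall>\<^sub>F n in sequentially. x j = \<tau> j n"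
    by metis
  have clx: "x j \<in> carrier (G j)" for j using x(1)[of j] cl by auto
  have "p (Suc j) j (x (Suc j)) = x j" for j
  proof -
    have "\<forall>\<^sub>F n in sequentially. p (Suc j) j (x (Suc j)) = x j"
      using x(2)[of j] x(2)[of "Suc j"] level_seqs_coherent[OF \<tau> le_SucI[OF order_refl], of j]
      by eventually_elim simp
    then show ?thesis by simp
  qed
  then have lim: "x \<in> carrier (inv_limit G p)" by (simp add: in_inv_limit_iff clx)
  have "constant_class x = X"
    by (rule level_seqs_unique[OF level_seqs_constant_class[OF lim] \<tau> x(2)])
  with lim show "X \<in> constant_class ` carrier (inv_limit G p)" by blast
qed

text \<open>
  A zigzag between \<open>X\<close> and \<open>z\<close>: applied to the double sequence \<open>\<sigma>\<close>, the shift in \<open>n\<close> gives \<open>X\<close>,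
  and \<open>lim_diff\<close> in \<open>j\<close> gives \<open>z\<close>. The second value measures how far \<open>\<sigma>\<close> is from being
  compatible with the bonding maps, that is, from defining an element of the asymptotic limit.
\<close>

definition linked :: "'a asym_seq set \<Rightarrow> (nat \<Rightarrow> 'a) \<Rightarrow> bool" where
  "linked X z \<longleftrightarrow> z \<in> carrier P \<and>
    (\<exists>\<sigma>. (\<forall>j n. \<sigma> j n \<in> carrier (G j)) \<and>
       level_seqs G p X (\<lambda>j n. \<sigma> j n \<otimes>\<^bsub>G j\<^esub> inv\<^bsub>G j\<^esub> \<sigma> j (Suc n)) \<and>
       (\<forall>j. \<forall>\<^sub>F n in sequentially. z j = \<sigma> j n \<otimes>\<^bsub>G j\<^esub> inv\<^bsub>G j\<^esub> p (Suc j) j (\<sigma> (Suc j) n)))"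

lemma linkedI:
  assumes "\<And>j n. \<sigma> j n \<in> carrier (G j)"
    and "level_seqs G p X (\<lambda>j n. \<sigma> j n \<otimes>\<^bsub>G j\<^esub> inv\<^bsub>G j\<^esub> \<sigma> j (Suc n))"
    and "\<And>j. \<forall>\<^sub>F n in sequentially. z j = \<sigma> j n \<otimes>\<^bsub>G j\<^esub> inv\<^bsub>G j\<^esub> p (Suc j) j (\<sigma> (Suc j) n)"
  shows "linked X z"
proof -
  have "z j \<in> carrier (G j)" for j
  proof -
    have "\<forall>\<^sub>F n in sequentially. z j \<in> carrier (G j)"
      using assms(3)[of j] by eventually_elim (simp add: assms(1) obj_simps)
    then show ?thesis by simp
  qed
  with assms show ?thesis unfolding linked_def in_product_iff by blast
qed

lemma linkedE:
  assumes "linked X z"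
  obtains \<sigma> where "\<And>j n. \<sigma> j n \<in> carrier (G j)"
    "level_seqs G p X (\<lambda>j n. \<sigma> j n \<otimes>\<^bsub>G j\<^esub> inv\<^bsub>G j\<^esub> \<sigma> j (Suc n))"
    "\<And>j. \<forall>\<^sub>F n in sequentially. z j = \<sigma> j n \<otimes>\<^bsub>G j\<^esub> inv\<^bsub>G j\<^esub> p (Suc j) j (\<sigma> (Suc j) n)"
  using assms unfolding linked_def in_product_iff by blast

lemma linked_mult:
  assumes "linked X z" "linked Y w"
  shows "linked (X \<otimes>\<^bsub>W\<^esub> Y) (z \<otimes>\<^bsub>P\<^esub> w)"
proof -
  obtain \<sigma> where \<sigma>: "\<And>j n. \<sigma> j n \<in> carrier (G j)"
    "level_seqs G p X (\<lambda>j n. \<sigma> j n \<otimes>\<^bsub>G j\<^esub> inv\<^bsub>G j\<^esub> \<sigma> j (Suc n))"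
    "\<And>j. \<forall>\<^sub>F n in sequentially. z j = \<sigma> j n \<otimes>\<^bsub>G j\<^esub> inv\<^bsub>G j\<^esub> p (Suc j) j (\<sigma> (Suc j) n)"
    using assms(1) by (rule linkedE) (rule that)
  obtain \<rho> where \<rho>: "\<And>j n. \<rho> j n \<in> carrier (G j)"
    "level_seqs G p Y (\<lambda>j n. \<rho> j n \<otimes>\<^bsub>G j\<^esub> inv\<^bsub>G j\<^esub> \<rho> j (Suc n))"
    "\<And>j. \<forall>\<^sub>F n in sequentially. w j = \<rho> j n \<otimes>\<^bsub>G j\<^esub> inv\<^bsub>G j\<^esub> p (Suc j) j (\<rho> (Suc j) n)"
    using assms(2) by (rule linkedE) (rule that)
  show ?thesis
  proof (rule linkedI[where \<sigma> = "\<lambda>j n. \<sigma> j n \<otimes>\<^bsub>G j\<^esub> \<rho> j n"])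
    show "level_seqs G p (X \<otimes>\<^bsub>W\<^esub> Y)
        (\<lambda>j n. (\<sigma> j n \<otimes>\<^bsub>G j\<^esub> \<rho> j n) \<otimes>\<^bsub>G j\<^esub> inv\<^bsub>G j\<^esub> (\<sigma> j (Suc n) \<otimes>\<^bsub>G j\<^esub> \<rho> j (Suc n)))"
      using level_seqs_mult[OF \<sigma>(2) \<rho>(2)]
      by (simp add: comm_group.mult_quotients[OF comm] \<sigma>(1) \<rho>(1))
    show "\<forall>\<^sub>F n in sequentially. (z \<otimes>\<^bsub>P\<^esub> w) j = (\<sigma> j n \<otimes>\<^bsub>G j\<^esub> \<rho> j n) \<otimes>\<^bsub>G j\<^esub>
        inv\<^bsub>G j\<^esub> p (Suc j) j (\<sigma> (Suc j) n \<otimes>\<^bsub>G (Suc j)\<^esub> \<rho> (Suc j) n)" for j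
      using \<sigma>(3)[of j] \<rho>(3)[of j]
      by eventually_elim (simp add: comm_group.mult_quotients[OF comm] \<sigma>(1) \<rho>(1) bond_mult bond_closed)
  qed (simp add: \<sigma>(1) \<rho>(1) obj_simps)
qed

lemma linked_inv:
  assumes "linked X z"
  shows "linked (inv\<^bsub>W\<^esub> X) (inv\<^bsub>P\<^esub> z)"
proof -
  obtain \<sigma> where \<sigma>: "\<And>j n. \<sigma> j n \<in> carrier (G j)"
    "level_seqs G p X (\<lambda>j n. \<sigma> j n \<otimes>\<^bsub>G j\<^esub> inv\<^bsub>G j\<^esub> \<sigma> j (Suc n))"
    "\<And>j. \<forall>\<^sub>F n in sequentially. z j = \<sigma> j n \<otimes>\<^bsub>G j\<^esub> inv\<^bsub>G j\<^esub> p (Suc j) j (\<sigma> (Suc j) n)"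
    using assms by (rule linkedE) (rule that)
  have z': "(inv\<^bsub>P\<^esub> z) j = inv\<^bsub>G j\<^esub> z j" for j
    using assms by (simp add: linked_def group_obj)
  show ?thesis
  proof (rule linkedI[where \<sigma> = "\<lambda>j n. inv\<^bsub>G j\<^esub> \<sigma> j n"])
    show "level_seqs G p (inv\<^bsub>W\<^esub> X)
        (\<lambda>j n. inv\<^bsub>G j\<^esub> \<sigma> j n \<otimes>\<^bsub>G j\<^esub> inv\<^bsub>G j\<^esub> (inv\<^bsub>G j\<^esub> \<sigma> j (Suc n)))"
      using level_seqs_inv[OF \<sigma>(2)] by (simp add: comm_group.inv_quotient[OF comm] \<sigma>(1) del: group.inv_inv)
    show "\<forall>\<^sub>F n in sequentially. (inv\<^bsub>P\<^esub> z) j = inv\<^bsub>G j\<^esub> \<sigma> j n \<otimes>\<^bsub>G j\<^esub>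
        inv\<^bsub>G j\<^esub> p (Suc j) j (inv\<^bsub>G (Suc j)\<^esub> \<sigma> (Suc j) n)" for j
      using \<sigma>(3)[of j] unfolding z'
      by eventually_elim
        (simp add: comm_group.inv_quotient[OF comm] \<sigma>(1) bond_inv bond_closed del: group.inv_inv)
  qed (simp add: \<sigma>(1) obj_simps)
qed

text \<open>
  For \<open>X = 1\<close> the sequences \<open>\<sigma> j\<close> are eventually constant, and \<open>lim_diff\<close> maps the sequence of their
  limits to \<open>z\<close>.
\<close>

lemma linked_one_left_iff: "linked \<one>\<^bsub>W\<^esub> z \<longleftrightarrow> z \<in> \<Delta> ` carrier P"
proof
  assume "z \<in> \<Delta> ` carrier P"
  then obtain w where "w \<in> carrier P" and z: "z = \<Delta> w" by blast
  then have w: "w j \<in> carrier (G j)" for j unfolding in_product_iff by blast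
  show "linked \<one>\<^bsub>W\<^esub> z"
  proof (rule linkedI[where \<sigma> = "\<lambda>j n. w j"])
    show "level_seqs G p \<one>\<^bsub>W\<^esub> (\<lambda>j n. w j \<otimes>\<^bsub>G j\<^esub> inv\<^bsub>G j\<^esub> w j)"
      using level_seqs_one by (simp add: group.r_inv[OF group_obj] w)
  qed (simp_all add: w z lim_diff_def)
next
  assume "linked \<one>\<^bsub>W\<^esub> z"
  then obtain \<sigma> where \<sigma>: "\<And>j n. \<sigma> j n \<in> carrier (G j)"
    "level_seqs G p \<one>\<^bsub>W\<^esub> (\<lambda>j n. \<sigma> j n \<otimes>\<^bsub>G j\<^esub> inv\<^bsub>G j\<^esub> \<sigma> j (Suc n))"
    "\<And>j. \<forall>\<^sub>F n in sequentially. z j = \<sigma> j n \<otimes>\<^bsub>G j\<^esub> inv\<^bsub>G j\<^esub> p (Suc j) j (\<sigma> (Suc j) n)"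
    by (rule linkedE) (rule that)
  have "\<forall>\<^sub>F n in sequentially. \<sigma> j n \<otimes>\<^bsub>G j\<^esub> inv\<^bsub>G j\<^esub> \<sigma> j (Suc n) = \<one>\<^bsub>G j\<^esub>" for j
    using eq_one_iff_levels[OF \<sigma>(2)] by simp
  then have "\<forall>\<^sub>F n in sequentially. \<sigma> j n = \<sigma> j (Suc n)" for j
    by (simp add: group.quotient_eq_one_iff[OF group_obj] \<sigma>(1))
  then have "\<exists>c. c \<in> range (\<sigma> j) \<and> (\<forall>\<^sub>F n in sequentially. c = \<sigma> j n)" for j
    using eventually_constant[of "\<sigma> j"] by blast
  then obtain w where w: "\<And>j. w j \<in> range (\<sigma> j)" "\<And>j. \<forall>\<^sub>F n in sequentially. w j = \<sigma> j n"
    by metis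
  have "z j = w j \<otimes>\<^bsub>G j\<^esub> inv\<^bsub>G j\<^esub> p (Suc j) j (w (Suc j))" for j
  proof -
    have "\<forall>\<^sub>F n in sequentially. z j = w j \<otimes>\<^bsub>G j\<^esub> inv\<^bsub>G j\<^esub> p (Suc j) j (w (Suc j))"
      using \<sigma>(3)[of j] w(2)[of j] w(2)[of "Suc j"] by eventually_elim simp
    then show ?thesis by simp
  qed
  then have "z = \<Delta> w" by (simp add: lim_diff_def fun_eq_iff)
  moreover have "w \<in> carrier P"
    unfolding in_product_iff using w(1) \<sigma>(1) by (metis imageE)
  ultimately show "z \<in> \<Delta> ` carrier P" by blast
qed

text \<open>
  Defect \<open>1\<close> means that \<open>\<sigma>\<close> is compatible, so it is realized by an element whose shift is \<open>X\<close>.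
\<close>

lemma linked_one_right_iff: "linked X \<one>\<^bsub>P\<^esub> \<longleftrightarrow> X \<in> \<Phi> ` carrier W"
proof
  assume "X \<in> \<Phi> ` carrier W"
  then obtain Y where Y: "Y \<in> carrier W" "X = \<Phi> Y" by blast
  obtain \<sigma> where \<sigma>: "level_seqs G p Y \<sigma>" using level_seqs_exist[OF Y(1)] .
  show "linked X \<one>\<^bsub>P\<^esub>"
  proof (rule linkedI[where \<sigma> = \<sigma>])
    show "level_seqs G p X (\<lambda>j n. \<sigma> j n \<otimes>\<^bsub>G j\<^esub> inv\<^bsub>G j\<^esub> \<sigma> j (Suc n))"
      using level_seqs_shift[OF \<sigma>] Y(2) by simp
    show "\<forall>\<^sub>F n in sequentially.
        \<one>\<^bsub>P\<^esub> j = \<sigma> j n \<otimes>\<^bsub>G j\<^esub> inv\<^bsub>G j\<^esub> p (Suc j) j (\<sigma> (Suc j) n)" for j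
      using level_seqs_coherent[OF \<sigma> le_SucI[OF order_refl], of j]
      by eventually_elim (simp add: group.r_inv[OF group_obj] level_seqs_closed[OF \<sigma>])
  qed (rule level_seqs_closed[OF \<sigma>])
next
  assume "linked X \<one>\<^bsub>P\<^esub>"
  then obtain \<sigma> where \<sigma>: "\<And>j n. \<sigma> j n \<in> carrier (G j)"
    "level_seqs G p X (\<lambda>j n. \<sigma> j n \<otimes>\<^bsub>G j\<^esub> inv\<^bsub>G j\<^esub> \<sigma> j (Suc n))"
    "\<And>j. \<forall>\<^sub>F n in sequentially. \<one>\<^bsub>P\<^esub> j = \<sigma> j n \<otimes>\<^bsub>G j\<^esub> inv\<^bsub>G j\<^esub> p (Suc j) j (\<sigma> (Suc j) n)"
    by (rule linkedE) (rule that)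
  have "\<forall>\<^sub>F n in sequentially. p (Suc j) j (\<sigma> (Suc j) n) = \<sigma> j n" for j
    using \<sigma>(3)[of j]
  proof eventually_elim
    case (elim n)
    then have "\<sigma> j n \<otimes>\<^bsub>G j\<^esub> inv\<^bsub>G j\<^esub> p (Suc j) j (\<sigma> (Suc j) n) = \<one>\<^bsub>G j\<^esub>" by simp
    then show ?case by (simp add: group.quotient_eq_one_iff[OF group_obj] \<sigma>(1) bond_closed)
  qed
  then obtain Y where Y: "level_seqs G p Y \<sigma>" using level_seqs_realize[of \<sigma>] \<sigma>(1) by blast
  have "\<Phi> Y = X" by (rule level_seqs_unique[OF level_seqs_shift[OF Y] \<sigma>(2)]) simp
  with level_seqs_in_carrier[OF Y] show "X \<in> \<Phi> ` carrier W" by blast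
qed

text \<open>
  Additively, the negated partial sums \<open>\<sigma> j n\<close> of \<open>\<tau> j\<close> solve the shift equation. Passing from
  \<open>n\<close> to \<open>n + 1\<close> subtracts \<open>\<tau> j n\<close> from \<open>\<sigma> j n\<close> and \<open>p (\<tau> (j + 1) n) = \<tau> j n\<close> from \<open>p (\<sigma> (j + 1) n)\<close>, so the
  defect does not change once \<open>\<tau>\<close> is compatible.
\<close>

lemma linked_total_left:
  assumes "X \<in> carrier W"
  obtains z where "linked X z"
proof -
  obtain \<tau> where \<tau>: "level_seqs G p X \<tau>" using level_seqs_exist[OF assms] .
  note cl = level_seqs_closed[OF \<tau>]
  define \<sigma> where "\<sigma> j n = rec_nat \<one>\<^bsub>G j\<^esub> (\<lambda>n s. s \<otimes>\<^bsub>G j\<^esub> inv\<^bsub>G j\<^esub> \<tau> j n) n" for j n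
  have rec: "\<sigma> j (Suc n) = \<sigma> j n \<otimes>\<^bsub>G j\<^esub> inv\<^bsub>G j\<^esub> \<tau> j n" for j n by (simp add: \<sigma>_def)
  have cl\<sigma>: "\<sigma> j n \<in> carrier (G j)" for j n
    by (induction n) (simp_all add: \<sigma>_def obj_simps cl)
  have diff: "\<sigma> j n \<otimes>\<^bsub>G j\<^esub> inv\<^bsub>G j\<^esub> \<sigma> j (Suc n) = \<tau> j n" for j n
  proof -
    interpret comm_group "G j" by (rule comm)
    show ?thesis
      unfolding rec using cl\<sigma>[of j n] cl[of j n] by (simp add: inv_mult m_assoc[symmetric])
  qed
  let ?e = "\<lambda>j n. \<sigma> j n \<otimes>\<^bsub>G j\<^esub> inv\<^bsub>G j\<^esub> p (Suc j) j (\<sigma> (Suc j) n)"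
  have "\<forall>\<^sub>F n in sequentially. ?e j n = ?e j (Suc n)" for j
    using level_seqs_coherent[OF \<tau> le_SucI[OF order_refl], of j]
    by eventually_elim (simp add: rec obj_simps cl cl\<sigma> comm_group.quotient_cancel_right[OF comm])
  then have "\<exists>c. \<forall>\<^sub>F n in sequentially. c = ?e j n" for j
    using eventually_constant[of "?e j"] by blast
  then obtain z where z: "\<And>j. \<forall>\<^sub>F n in sequentially. z j = ?e j n" by metis
  have "linked X z" by (rule linkedI[OF cl\<sigma> _ z]) (use \<tau> in \<open>simp add: diff\<close>)
  then show ?thesis by (rule that)
qed

text \<open>
  Additively, with \<open>\<sigma> j n\<close> the sum of \<open>p i j (z i)\<close> over \<open>j \<le> i < n\<close>, the defect at level
  \<open>j\<close> is the summand \<open>z j\<close> as soon as \<open>n > j\<close>, and the shift equation produces the sequence of the negated \<open>z n\<close>.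
\<close>

lemma linked_total_right:
  assumes "z \<in> carrier P"
  obtains X where "linked X z"
proof -
  have cl: "z j \<in> carrier (G j)" for j using assms by (simp add: PiE_iff)
  define \<sigma> where "\<sigma> j n =
    rec_nat \<one>\<^bsub>G j\<^esub> (\<lambda>n s. if j \<le> n then s \<otimes>\<^bsub>G j\<^esub> p n j (z n) else s) n" for j n
  have rec: "\<sigma> j (Suc n) = (if j \<le> n then \<sigma> j n \<otimes>\<^bsub>G j\<^esub> p n j (z n) else \<sigma> j n)" for j n
    by (simp add: \<sigma>_def)
  have cl\<sigma>: "\<sigma> j n \<in> carrier (G j)" for j n
    by (induction n) (simp_all add: \<sigma>_def obj_simps cl)
  have empty: "\<sigma> j n = \<one>\<^bsub>G j\<^esub>" if "n \<le> j" for j n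
    using that by (induction n) (simp_all add: \<sigma>_def)
  have step: "\<sigma> j n = z j \<otimes>\<^bsub>G j\<^esub> p (Suc j) j (\<sigma> (Suc j) n)" if "Suc j \<le> n" for j n
    using that
  proof (induction rule: dec_induct)
    case base
    interpret comm_group "G j" by (rule comm)
    show ?case by (simp add: rec empty bond_one bond_id cl)
  next
    case (step n)
    interpret comm_group "G j" by (rule comm)
    have "\<sigma> j (Suc n) = z j \<otimes>\<^bsub>G j\<^esub> p (Suc j) j (\<sigma> (Suc j) n) \<otimes>\<^bsub>G j\<^esub> p n j (z n)"
      using step by (simp add: rec)
    also have "\<dots> = z j \<otimes>\<^bsub>G j\<^esub> p (Suc j) j (\<sigma> (Suc j) (Suc n))"
      using step(1) by (simp add: rec bond_mult bond_closed bond_comp cl cl\<sigma> m_assoc)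
    finally show ?case .
  qed
  have s: "(\<lambda>n. n, \<lambda>n. inv\<^bsub>G n\<^esub> z n) \<in> asym_seqs G"
    by (simp add: asym_seqs_iff cl obj_simps filterlim_ident)
  have "linked (asym_class G p (\<lambda>n. n, \<lambda>n. inv\<^bsub>G n\<^esub> z n)) z"
  proof (rule linkedI[OF cl\<sigma>])
    show "level_seqs G p (asym_class G p (\<lambda>n. n, \<lambda>n. inv\<^bsub>G n\<^esub> z n))
        (\<lambda>j n. \<sigma> j n \<otimes>\<^bsub>G j\<^esub> inv\<^bsub>G j\<^esub> \<sigma> j (Suc n))"
      unfolding level_seqs_asym_class_iff[OF s]
    proof (intro conjI allI)
      show "\<sigma> j n \<otimes>\<^bsub>G j\<^esub> inv\<^bsub>G j\<^esub> \<sigma> j (Suc n) \<in> carrier (G j)" for j n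
        by (simp add: cl\<sigma> obj_simps)
      fix j
      interpret comm_group "G j" by (rule comm)
      show "\<forall>\<^sub>F n in sequentially.
          p n j (inv\<^bsub>G n\<^esub> z n) = \<sigma> j n \<otimes>\<^bsub>G j\<^esub> inv\<^bsub>G j\<^esub> \<sigma> j (Suc n)"
        using eventually_ge_at_top[of j]
        by eventually_elim
          (simp add: rec inv_mult m_assoc[symmetric] bond_closed bond_inv cl cl\<sigma>)
    qed
    fix j
    interpret comm_group "G j" by (rule comm)
    show "\<forall>\<^sub>F n in sequentially. z j = \<sigma> j n \<otimes>\<^bsub>G j\<^esub> inv\<^bsub>G j\<^esub> p (Suc j) j (\<sigma> (Suc j) n)"
      using eventually_ge_at_top[of "Suc j"]
      by eventually_elim (simp add: step m_assoc bond_closed cl cl\<sigma>)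
  qed
  then show ?thesis by (rule that)
qed

text \<open>
  The elements of \<open>inv_limit1 G p\<close> are cosets, and the set of all \<open>z\<close> linked to \<open>X\<close> is such a
  coset, so no choice of \<open>z\<close> is needed.
\<close>

definition to_lim1 :: "'a asym_seq set \<Rightarrow> (nat \<Rightarrow> 'a) set" where
  "to_lim1 X = {z. linked X z}"

lemma normal_image_lim_diff: "(\<Delta> ` carrier P) \<lhd> P"
  using group_hom.img_is_subgroup[OF group_hom_lim_diff]
  by (rule comm_group.subgroup_imp_normal[OF comm_group_product])

lemma to_lim1_eq_coset:
  assumes "linked X z"
  shows "to_lim1 X = (\<Delta> ` carrier P) #>\<^bsub>P\<^esub> z"
proof -
  interpret W: group W by (rule group_asym_limit)
  interpret P: comm_group P by (rule comm_group_product)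
  have X: "X \<in> carrier W" using assms level_seqs_in_carrier by (auto simp: linked_def)
  have mem: "u \<in> carrier P" if "linked Y u" for Y u using that by (simp add: linked_def)
  have "linked X u \<longleftrightarrow> u \<in> (\<Delta> ` carrier P) #>\<^bsub>P\<^esub> z" for u
  proof
    assume u: "linked X u"
    have "linked \<one>\<^bsub>W\<^esub> (u \<otimes>\<^bsub>P\<^esub> inv\<^bsub>P\<^esub> z)"
      using linked_mult[OF u linked_inv[OF assms]] X by (simp only: W.r_inv)
    then have "u \<otimes>\<^bsub>P\<^esub> inv\<^bsub>P\<^esub> z \<in> \<Delta> ` carrier P" by (simp only: linked_one_left_iff)
    moreover have "u = (u \<otimes>\<^bsub>P\<^esub> inv\<^bsub>P\<^esub> z) \<otimes>\<^bsub>P\<^esub> z"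
      using mem[OF u] mem[OF assms] by (simp only: P.m_assoc P.inv_closed P.l_inv P.r_one)
    ultimately show "u \<in> (\<Delta> ` carrier P) #>\<^bsub>P\<^esub> z"
      unfolding r_coset_def by blast
  next
    assume "u \<in> (\<Delta> ` carrier P) #>\<^bsub>P\<^esub> z"
    then obtain h where h: "h \<in> \<Delta> ` carrier P" "u = h \<otimes>\<^bsub>P\<^esub> z" unfolding r_coset_def by blast
    then have "linked \<one>\<^bsub>W\<^esub> h" by (simp only: linked_one_left_iff)
    from linked_mult[OF this assms] X show "linked X u" by (simp only: h(2) W.l_one)
  qed
  then show ?thesis by (auto simp: to_lim1_def)
qed

lemma group_hom_to_lim1: "group_hom W (inv_limit1 G p) to_lim1"
proof (intro group_hom.intro group_hom_axioms.intro group_asym_limit homI)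
  interpret N: normal "\<Delta> ` carrier P" P by (rule normal_image_lim_diff)
  show "group (inv_limit1 G p)" unfolding inv_limit1_def by (rule N.factorgroup_is_group)
  show "to_lim1 X \<in> carrier (inv_limit1 G p)" if X: "X \<in> carrier W" for X
  proof -
    obtain z where z: "linked X z" using linked_total_left[OF X] .
    then have "z \<in> carrier P" by (simp add: linked_def)
    with to_lim1_eq_coset[OF z] show ?thesis
      unfolding inv_limit1_def carrier_FactGroup by blast
  qed
  show "to_lim1 (X \<otimes>\<^bsub>W\<^esub> Y) = to_lim1 X \<otimes>\<^bsub>inv_limit1 G p\<^esub> to_lim1 Y"
    if XY: "X \<in> carrier W" "Y \<in> carrier W" for X Y
  proof -
    obtain z w where z: "linked X z" and w: "linked Y w"
      using linked_total_left XY by metis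
    then have "z \<in> carrier P" "w \<in> carrier P" by (simp_all add: linked_def)
    then show ?thesis
      unfolding to_lim1_eq_coset[OF linked_mult[OF z w]] to_lim1_eq_coset[OF z]
        to_lim1_eq_coset[OF w] inv_limit1_def mult_FactGroup
      by (rule N.rcos_sum[symmetric])
  qed
qed

lemma kernel_to_lim1: "kernel W (inv_limit1 G p) to_lim1 = \<Phi> ` carrier W"
proof -
  interpret S: group_hom W W \<Phi> by (rule group_hom_shift)
  interpret P: comm_group P by (rule comm_group_product)
  have "to_lim1 X = \<one>\<^bsub>inv_limit1 G p\<^esub> \<longleftrightarrow> linked X \<one>\<^bsub>P\<^esub>" if "X \<in> carrier W" for X
  proof -
    have sub: "subgroup (\<Delta> ` carrier P) P"
      by (rule group_hom.img_is_subgroup[OF group_hom_lim_diff])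
    have one: "\<one>\<^bsub>inv_limit1 G p\<^esub> = \<Delta> ` carrier P" by (simp only: inv_limit1_def one_FactGroup)
    show ?thesis
    proof
      assume "to_lim1 X = \<one>\<^bsub>inv_limit1 G p\<^esub>"
      then have "\<one>\<^bsub>P\<^esub> \<in> to_lim1 X" using subgroup.one_closed[OF sub] by (simp only: one)
      then show "linked X \<one>\<^bsub>P\<^esub>" by (simp only: to_lim1_def mem_Collect_eq)
    next
      assume "linked X \<one>\<^bsub>P\<^esub>"
      from to_lim1_eq_coset[OF this] show "to_lim1 X = \<one>\<^bsub>inv_limit1 G p\<^esub>"
        using P.coset_join2[OF P.one_closed sub subgroup.one_closed[OF sub]] by (simp only: one)
    qed
  qed
  then show ?thesis
    unfolding kernel_def linked_one_right_iff using S.hom_closed by blast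
qed

lemma to_lim1_surj: "to_lim1 ` carrier W = carrier (inv_limit1 G p)"
proof (intro equalityI subsetI)
  show "Z \<in> carrier (inv_limit1 G p)" if "Z \<in> to_lim1 ` carrier W" for Z
    using that group_hom.hom_closed[OF group_hom_to_lim1] by blast
  fix Z assume "Z \<in> carrier (inv_limit1 G p)"
  then obtain z where z: "z \<in> carrier P" "Z = (\<Delta> ` carrier P) #>\<^bsub>P\<^esub> z"
    unfolding inv_limit1_def carrier_FactGroup by blast
  obtain X where X: "linked X z" using linked_total_right[OF z(1)] .
  then have "X \<in> carrier W" using level_seqs_in_carrier by (auto simp: linked_def)
  with to_lim1_eq_coset[OF X] z(2) show "Z \<in> to_lim1 ` carrier W" by blast
qed

theorem six_term_exact:
  "exact_at (singleton_group ()) (\<lambda>_. \<one>\<^bsub>inv_limit G p\<^esub>) (inv_limit G p) constant_class W"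
  "exact_at (inv_limit G p) constant_class W \<Phi> W"
  "exact_at W \<Phi> W to_lim1 (inv_limit1 G p)"
  "exact_at W to_lim1 (inv_limit1 G p) (\<lambda>_. ()) (singleton_group ())"
proof -
  interpret C: group_hom "inv_limit G p" W constant_class by (rule group_hom_constant_class)
  interpret Q: group_hom W "inv_limit1 G p" to_lim1 by (rule group_hom_to_lim1)
  have from_trivial: "group_hom (singleton_group ()) (inv_limit G p) (\<lambda>_. \<one>\<^bsub>inv_limit G p\<^esub>)"
    by (intro group_hom.intro group_hom_axioms.intro group_inv_limit) (auto simp: hom_def)
  have to_trivial: "group_hom (inv_limit1 G p) (singleton_group ()) (\<lambda>_. ())"
    by (intro group_hom.intro group_hom_axioms.intro) auto
  have "kernel (inv_limit G p) W constant_class = {\<one>\<^bsub>inv_limit G p\<^esub>}"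
    using constant_class_eq_one by (auto simp: kernel_def)
  then show "exact_at (singleton_group ()) (\<lambda>_. \<one>\<^bsub>inv_limit G p\<^esub>) (inv_limit G p) constant_class W"
    using from_trivial group_hom_constant_class by (simp add: exact_at_def)
  show "exact_at (inv_limit G p) constant_class W \<Phi> W"
    using group_hom_constant_class group_hom_shift kernel_shift by (simp add: exact_at_def)
  show "exact_at W \<Phi> W to_lim1 (inv_limit1 G p)"
    using group_hom_shift group_hom_to_lim1 kernel_to_lim1 by (simp add: exact_at_def)
  have "kernel (inv_limit1 G p) (singleton_group ()) (\<lambda>_. ()) = carrier (inv_limit1 G p)"
    by (simp add: kernel_def singleton_group_def)
  then show "exact_at W to_lim1 (inv_limit1 G p) (\<lambda>_. ()) (singleton_group ())"
    using group_hom_to_lim1 to_trivial to_lim1_surj by (simp add: exact_at_def)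
qed

end

section \<open>The asymptotic limit functor\<close>

theorem theorem1p2:
  fixes A :: "nat \<Rightarrow> 'a monoid" and a :: "nat \<Rightarrow> nat \<Rightarrow> 'a \<Rightarrow> 'a"
    and B :: "nat \<Rightarrow> 'b monoid" and b :: "nat \<Rightarrow> nat \<Rightarrow> 'b \<Rightarrow> 'b"
    and C :: "nat \<Rightarrow> 'c monoid" and c :: "nat \<Rightarrow> nat \<Rightarrow> 'c \<Rightarrow> 'c"
    and \<phi> :: "nat \<Rightarrow> 'a \<Rightarrow> 'b" and \<psi> :: "nat \<Rightarrow> 'b \<Rightarrow> 'c"
    and G :: "nat \<Rightarrow> 'g monoid" and p :: "nat \<Rightarrow> nat \<Rightarrow> 'g \<Rightarrow> 'g"
    and D :: "nat \<Rightarrow> 'd monoid" and d :: "nat \<Rightarrow> nat \<Rightarrow> 'd \<Rightarrow> 'd"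
  shows
    "(inverse_system_morphism A a B b \<phi> \<and> inverse_system_morphism B b C c \<psi> \<and>
        (\<forall>n. short_exact (A n) (\<phi> n) (B n) (\<psi> n) (C n)) \<longrightarrow>
      short_exact (asym_limit A a) (asym_map B b \<phi>)
                  (asym_limit B b) (asym_map C c \<psi>) (asym_limit C c)) \<and>
     (inverse_system G p \<longrightarrow>
        group (asym_limit G p) \<and>
        (trivial_group (asym_limit G p) \<longleftrightarrow>
           pro_isomorphic G p trivial_system trivial_bond) \<and>
        (\<not> pro_isomorphic G p trivial_system trivial_bond \<longrightarrow>
           uncountable (carrier (asym_limit G p)))) \<and>
     (inverse_system D d \<and> (\<forall>n. comm_group (D n)) \<longrightarrow>
        (\<exists>\<iota> \<pi>.
           exact_at (singleton_group ()) (\<lambda>_. \<one>\<^bsub>inv_limit D d\<^esub>) (inv_limit D d)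
                    \<iota> (asym_limit D d) \<and>
           exact_at (inv_limit D d) \<iota> (asym_limit D d) (asym_shift D d) (asym_limit D d) \<and>
           exact_at (asym_limit D d) (asym_shift D d) (asym_limit D d) \<pi> (inv_limit1 D d) \<and>
           exact_at (asym_limit D d) \<pi> (inv_limit1 D d)
                    (\<lambda>_. ()) (singleton_group ())))"
proof (intro conjI impI)
  show "short_exact (asym_limit A a) (asym_map B b \<phi>) (asym_limit B b) (asym_map C c \<psi>) (asym_limit C c)"
    if "inverse_system_morphism A a B b \<phi> \<and> inverse_system_morphism B b C c \<psi> \<and>
        (\<forall>n. short_exact (A n) (\<phi> n) (B n) (\<psi> n) (C n))"
    using that by (intro short_exact_asym_limit) auto
next
  assume "inverse_system G p"
  then interpret inverse_system G p .
  show "group (asym_limit G p)" by (rule group_asym_limit)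
  show uncountable: "uncountable (carrier (asym_limit G p))"
    if "\<not> pro_isomorphic G p trivial_system trivial_bond"
    using asym_limit_uncountable[OF that] .
  show "trivial_group (asym_limit G p) \<longleftrightarrow> pro_isomorphic G p trivial_system trivial_bond"
  proof
    assume "trivial_group (asym_limit G p)"
    then have "countable (carrier (asym_limit G p))" by (simp add: trivial_group_def)
    with uncountable show "pro_isomorphic G p trivial_system trivial_bond" by blast
  qed (rule asym_limit_trivial)
next
  assume D: "inverse_system D d \<and> (\<forall>n. comm_group (D n))"
  interpret abelian_inverse_system D d
    using D by (intro abelian_inverse_system.intro abelian_inverse_system_axioms.intro) auto
  show "\<exists>\<iota> \<pi>.
      exact_at (singleton_group ()) (\<lambda>_. \<one>\<^bsub>inv_limit D d\<^esub>) (inv_limit D d) \<iota> (asym_limit D d) \<and>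
      exact_at (inv_limit D d) \<iota> (asym_limit D d) (asym_shift D d) (asym_limit D d) \<and>
      exact_at (asym_limit D d) (asym_shift D d) (asym_limit D d) \<pi> (inv_limit1 D d) \<and>
      exact_at (asym_limit D d) \<pi> (inv_limit1 D d) (\<lambda>_. ()) (singleton_group ())"
    using six_term_exact by blast
qed

end
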